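(* Let $\Phi_0 \in \ell^1(\mathbb F_3,\omega)^{**}$ be the weak*-limit of a weak*-convergent subnet of the sequence $(g_k)_{k\in\mathbb N}$, where $g_k=\frac{1}{\omega(a^{5^{2k}}b^{5^{2k}})}\,\delta_{a^{5^{2k}}b^{5^{2k}}}$. Then $\Phi_0 \in \operatorname{rad}(\ell^1(\mathbb F_3, \omega)^{**}, \Box)$ but $\Phi_0 \notin \operatorname{rad}(\ell^1(\mathbb F_3, \omega)^{**}, \Diamond)$.
   Context: $\mathbb N=\{1,2,3,\dots\}$. $\mathbb F_3=\langle a,b,c\rangle$ is the free group on three generators with identity $1$ (the empty word). A subset $T$ generates a group $G$ if every $g\ne 1$ in $G$ is a product of elements of $T$ (i.e. $T$ generates $G$ as a monoid; $T$ need not be symmetric); then $|g|_T$ is the least $n$ such that $g$ is a product of $n$ elements of $T$ (with $|1|_T=0$). Let $S=\{a,b,c,a^{-1},b^{-1},c^{-1}\}$ and write $|u|=|u|_S$. For $j\in\mathbb N$ and $v\in\mathbb F_3$ with $|v|\le 5^j$ put $x(v,j)=v\,b^{5^{2j-1}}v^{-1}a^{5^{2j}}b^{5^{2j}}$. Let $X_j=\{x(v,j): v\in\mathbb F_3,\ |v|\le 5^j\}$, $X_\infty=\bigcup_{j=2}^\infty X_j$ and $X=X_\infty\cup S$. Define $\omega(t)=\exp(|t|_X)$ for $t\in\mathbb F_3$; this is a weight, i.e. $\omega(1)=1$ and $\omega(st)\le\omega(s)\omega(t)$. The Beurling algebra $\ell^1(\mathbb F_3,\omega)$ is the space of $f:\mathbb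 F_3\to\mathbb C$ with $\|f\|_\omega=\sum_t|f(t)|\omega(t)<\infty$, a Banach algebra under convolution $(f*g)(t)=\sum_s f(s)g(s^{-1}t)$; $\delta_u$ denotes the point mass at $u$. Its dual is $\{\lambda:\mathbb F_3\to\mathbb C:\ \lambda/\omega \text{ bounded}\}$. Arens products: for a Banach algebra $\mathcal A$, $x,y\in\mathcal A$, $\lambda\in\mathcal A^*$, $\Phi,\Psi\in\mathcal A^{**}$, put $\langle\lambda\cdot x,y\rangle=\langle\lambda,xy\rangle$, $\langle x\cdot\lambda,y\rangle=\langle\lambda,yx\rangle$, $\langle\Phi\cdot\lambda,x\rangle=\langle\Phi,\lambda\cdot x\rangle$, $\langle\lambda\cdot\Psi,x\rangle=\langle\Psi,x\cdot\lambda\rangle$, $\langle\Psi\Box\Phi,\lambda\rangle=\langle\Psi,\Phi\cdot\lambda\rangle$, $\langle\Psi\Diamond\Phi,\lambda\rangle=\langle\Phi,\lambda\cdot\Psi\rangle$. Both $\Box$ and $\Diamond$ make $\mathcal A^{**}$ a Banach algebra. An element $x$ of a Banach algebra is quasi-nilpotent if $\lim_{n\to\infty}\|x^n\|^{1/n}=0$ (for unital algebras, equivalently its spectrum is $\{0\}$). The Jacobson radical $\operatorname{rad}$ is the largest left (equivalently, right) ideal consisting of quasi-nilpotent elements. Subnets are in the sense of Willard: a subnet of $(x_\alpha)_{\alpha\in\Lambda}$ is $(x_{h(\beta)})_{\beta\in M}$ with $h:M\to\Lambda$ order-preserving and cofinal. *)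

theory Defs
  imports "HOL-Analysis.Analysis"
begin

section \<open>Complex normed algebras and their duals\<close>

class complex_normed_vector = real_normed_vector +
  fixes scaleC :: "complex \<Rightarrow> 'a \<Rightarrow> 'a"  (infixr \<open>*\<^sub>C\<close> 75)
  assumes scaleC_add_right: "c *\<^sub>C (x + y) = c *\<^sub>C x + c *\<^sub>C y"
    and scaleC_add_left: "(c + d) *\<^sub>C x = c *\<^sub>C x + d *\<^sub>C x"
    and scaleC_scaleC: "c *\<^sub>C (d *\<^sub>C x) = (c * d) *\<^sub>C x"
    and scaleC_of_real: "of_real r *\<^sub>C x = r *\<^sub>R x"
    and norm_scaleC: "norm (c *\<^sub>C x) = norm c * norm x"

class complex_normed_algebra = complex_normed_vector + real_normed_algebra +
  assumes mult_scaleC_left: "(c *\<^sub>C x) * y = c *\<^sub>C (x * y)"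
    and mult_scaleC_right: "x * (c *\<^sub>C y) = c *\<^sub>C (x * y)"

definition bounded_clinear :: "('a::complex_normed_vector \<Rightarrow> complex) \<Rightarrow> bool" where
  "bounded_clinear f \<longleftrightarrow> bounded_linear f \<and> (\<forall>c x. f (c *\<^sub>C x) = c * f x)"

lemma bounded_clinearI:
  assumes "\<And>x y. f (x + y) = f x + f y" "\<And>c x. f (c *\<^sub>C x) = c * f x"
    "\<And>x. norm (f x) \<le> K * norm x"
  shows "bounded_clinear f"
  unfolding bounded_clinear_def
proof (intro conjI allI assms(2))
  show "bounded_linear f"
  proof (rule bounded_linear_intro[of _ K])
    show "f (r *\<^sub>R x) = r *\<^sub>R f x" for r x
      using assms(2)[of "of_real r" x] by (simp add: scaleC_of_real scaleR_conv_of_real)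
  qed (use assms in \<open>auto simp: mult.commute\<close>)
qed

text \<open>The dual of a complex normed space consists of complex-linear functionals, unlike the
  real-linear \<open>'a \<Rightarrow>\<^sub>L complex\<close> of the library.\<close>

typedef (overloaded) 'a cdual = "{f :: 'a::complex_normed_vector \<Rightarrow> complex. bounded_clinear f}"
  morphisms capply CDual
  by (intro exI[of _ "\<lambda>_. 0"]) (auto intro!: bounded_clinearI[of _ 0])

setup_lifting type_definition_cdual

declare [[coercion "capply :: 'a::complex_normed_vector cdual \<Rightarrow> 'a \<Rightarrow> complex"]]

lemma capply_CDual: "bounded_clinear f \<Longrightarrow> capply (CDual f) = f"
  by (simp add: CDual_inverse)

lemma cdual_eqI: "(\<And>x. capply f x = capply g x) \<Longrightarrow> f = g"
  by transfer auto

lemma bounded_linear_capply: "bounded_linear (capply f)"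
  by transfer (simp add: bounded_clinear_def)

lemma capply_add: "capply f (x + y) = capply f x + capply f y"
  using bounded_linear_capply[of f] by (rule bounded_linear.axioms(1)[THEN linear_add])

lemma capply_scaleC: "capply f (c *\<^sub>C x) = c * capply f x"
  by transfer (simp add: bounded_clinear_def)

instantiation cdual :: (complex_normed_vector) complex_normed_vector
begin

lift_definition norm_cdual :: "'a cdual \<Rightarrow> real" is onorm .

lift_definition minus_cdual :: "'a cdual \<Rightarrow> 'a cdual \<Rightarrow> 'a cdual" is "\<lambda>f g x. f x - g x"
  by (auto simp: bounded_clinear_def algebra_simps intro: bounded_linear_sub)

lift_definition plus_cdual :: "'a cdual \<Rightarrow> 'a cdual \<Rightarrow> 'a cdual" is "\<lambda>f g x. f x + g x"
  by (auto simp: bounded_clinear_def algebra_simps intro: bounded_linear_add)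

lift_definition uminus_cdual :: "'a cdual \<Rightarrow> 'a cdual" is "\<lambda>f x. - f x"
  by (auto simp: bounded_clinear_def algebra_simps intro: bounded_linear_minus)

lift_definition zero_cdual :: "'a cdual" is "\<lambda>_. 0"
  by (auto simp: bounded_clinear_def)

lift_definition scaleR_cdual :: "real \<Rightarrow> 'a cdual \<Rightarrow> 'a cdual" is "\<lambda>r f x. r *\<^sub>R f x"
  by (auto simp: bounded_clinear_def intro: bounded_linear_const_scaleR)

lift_definition scaleC_cdual :: "complex \<Rightarrow> 'a cdual \<Rightarrow> 'a cdual" is "\<lambda>c f x. c * f x"
  by (auto simp: bounded_clinear_def intro: bounded_linear_const_mult)

definition dist_cdual :: "'a cdual \<Rightarrow> 'a cdual \<Rightarrow> real"
  where "dist_cdual f g = norm (f - g)"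

definition [code del]:
  "(uniformity :: ('a cdual \<times> 'a cdual) filter) = (INF e\<in>{0 <..}. principal {(x, y). dist x y < e})"

definition open_cdual :: "'a cdual set \<Rightarrow> bool"
  where [code del]: "open_cdual S = (\<forall>x\<in>S. \<forall>\<^sub>F (x', y) in uniformity. x' = x \<longrightarrow> y \<in> S)"

definition sgn_cdual :: "'a cdual \<Rightarrow> 'a cdual"
  where "sgn_cdual x = scaleR (inverse (norm x)) x"

instance
proof
  fix f g :: "'a cdual" and c :: complex
  show "norm (c *\<^sub>C f) = norm c * norm f"
  proof (transfer, unfold bounded_clinear_def, elim conjE)
    fix c :: complex and f :: "'a \<Rightarrow> complex" assume f: "bounded_linear f"
    show "onorm (\<lambda>x. c * f x) = norm c * onorm f"
      using onorm_scaleR[OF f, of "norm c"] by (simp add: onorm_def norm_mult)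
  qed
  show "norm (f + g) \<le> norm f + norm g"
    by transfer (auto simp: bounded_clinear_def intro: onorm_triangle)
  show "norm f = 0 \<longleftrightarrow> f = 0"
    by transfer (auto simp: bounded_clinear_def onorm_eq_0)
  show "norm (r *\<^sub>R f) = \<bar>r\<bar> * norm f" for r
    by transfer (auto simp: bounded_clinear_def onorm_scaleR)
qed (transfer; force simp: dist_cdual_def open_cdual_def sgn_cdual_def uniformity_cdual_def
    algebra_simps scaleR_conv_of_real)+

end

lemma norm_capply: "norm (capply f x) \<le> norm f * norm x"
  by transfer (auto simp: bounded_clinear_def intro: onorm)

lemma norm_cdual_bound: "0 \<le> b \<Longrightarrow> (\<And>x. norm (capply f x) \<le> b * norm x) \<Longrightarrow> norm f \<le> b"
  by transfer (auto intro: onorm_bound)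

instance cdual :: (complex_normed_vector) banach
proof
  fix X :: "nat \<Rightarrow> 'a cdual"
  assume X: "Cauchy X"
  define Y where "Y n = Blinfun (capply (X n))" for n
  have Y: "blinfun_apply (Y n) = capply (X n)" for n
    by (simp add: Y_def bounded_linear_Blinfun_apply bounded_linear_capply)
  have nY: "norm (f :: 'a cdual) = norm g" if "capply f = blinfun_apply g" for f g
    using that by (simp add: norm_cdual.rep_eq norm_blinfun.rep_eq)
  have "norm (X m - X n) = norm (Y m - Y n)" for m n
    by (rule nY) (auto simp: fun_eq_iff minus_cdual.rep_eq blinfun.diff_left Y)
  then have "Cauchy Y"
    using X by (simp add: Cauchy_def dist_norm)
  then obtain L where L: "Y \<longlonglongrightarrow> L"
    by (auto simp: convergent_eq_Cauchy[symmetric])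
  have Lx: "(\<lambda>n. capply (X n) x) \<longlonglongrightarrow> blinfun_apply L x" for x
    using bounded_bilinear.tendsto[OF bounded_bilinear_blinfun_apply L tendsto_const, of x] by (simp add: Y)
  have "blinfun_apply L (c *\<^sub>C x) = c * blinfun_apply L x" for c x
    using Lx[of "c *\<^sub>C x"] tendsto_mult_left[OF Lx[of x], of c]
    by (simp add: capply_scaleC LIMSEQ_unique)
  then have "bounded_clinear (blinfun_apply L)"
    by (simp add: bounded_clinear_def blinfun.bounded_linear_right)
  then have "norm (X n - CDual (blinfun_apply L)) = norm (Y n - L)" for n
    by (intro nY) (auto simp: fun_eq_iff minus_cdual.rep_eq blinfun.diff_left Y capply_CDual)
  then have "X \<longlonglongrightarrow> CDual (blinfun_apply L)"
    using L by (simp add: lim_sequentially dist_norm)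
  then show "convergent X"
    by (auto simp: convergent_def)
qed

lemma capply_add_left: "capply (f + g) x = capply f x + capply g x"
  by transfer simp

lemma capply_scaleC_left: "capply (c *\<^sub>C f) x = c * capply f x"
  by transfer simp

definition bidual_embed :: "'a::complex_normed_vector \<Rightarrow> 'a cdual cdual" where
  "bidual_embed x = CDual (\<lambda>l. capply l x)"

lemma bidual_embed_apply: "capply (bidual_embed x) l = capply l x"
  unfolding bidual_embed_def
  by (subst capply_CDual)
     (auto intro!: bounded_clinearI[of _ "norm x"] simp: capply_add_left capply_scaleC_left
       norm_capply mult.commute[of "norm x"])

definition weak_star_lim :: "('i \<Rightarrow> 'a::complex_normed_vector cdual) \<Rightarrow> 'a cdual \<Rightarrow> 'i filter \<Rightarrow> bool"
  where "weak_star_lim f \<Phi> F \<longleftrightarrow> (\<forall>l. ((\<lambda>i. capply (f i) l) \<longlongrightarrow> capply \<Phi> l) F)"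


section \<open>The Arens products\<close>

text \<open>The module actions \<open>\<lambda> \<cdot> x\<close> and \<open>x \<cdot> \<lambda>\<close> of an algebra on its dual.\<close>

definition dual_right :: "'a::complex_normed_algebra cdual \<Rightarrow> 'a \<Rightarrow> 'a cdual" where
  "dual_right l x = CDual (\<lambda>y. capply l (x * y))"

definition dual_left :: "'a::complex_normed_algebra \<Rightarrow> 'a cdual \<Rightarrow> 'a cdual" where
  "dual_left x l = CDual (\<lambda>y. capply l (y * x))"

text \<open>The actions \<open>\<Phi> \<cdot> \<lambda>\<close> and \<open>\<lambda> \<cdot> \<Psi>\<close> of the bidual on the dual.\<close>

definition bidual_left :: "'a::complex_normed_algebra cdual cdual \<Rightarrow> 'a cdual \<Rightarrow> 'a cdual" where
  "bidual_left \<Phi> l = CDual (\<lambda>x. capply \<Phi> (dual_right l x))"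

definition bidual_right :: "'a::complex_normed_algebra cdual \<Rightarrow> 'a cdual cdual \<Rightarrow> 'a cdual" where
  "bidual_right l \<Psi> = CDual (\<lambda>x. capply \<Psi> (dual_left x l))"

definition arens_box ::
    "'a::complex_normed_algebra cdual cdual \<Rightarrow> 'a cdual cdual \<Rightarrow> 'a cdual cdual"
    (infixl \<open>\<box>\<close> 70) where
  "\<Psi> \<box> \<Phi> = CDual (\<lambda>l. capply \<Psi> (bidual_left \<Phi> l))"

definition arens_diamond ::
    "'a::complex_normed_algebra cdual cdual \<Rightarrow> 'a cdual cdual \<Rightarrow> 'a cdual cdual"
    (infixl \<open>\<diamondop>\<close> 70) where
  "\<Psi> \<diamondop> \<Phi> = CDual (\<lambda>l. capply \<Phi> (bidual_right l \<Psi>))"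

text \<open>All the functionals passed to \<^const>\<open>CDual\<close> are bounded and complex-linear:\<close>

lemma dual_right_apply: "capply (dual_right l x) y = capply l (x * y)"
  and norm_dual_right: "norm (dual_right l x) \<le> norm l * norm x"
proof -
  have b: "norm (capply l (x * y)) \<le> norm l * norm x * norm y" for y
    by (rule order_trans[OF norm_capply])
       (simp add: mult.assoc mult_left_mono norm_mult_ineq)
  then show *: "capply (dual_right l x) y = capply l (x * y)" for y
    unfolding dual_right_def
    by (subst capply_CDual)
       (auto intro!: bounded_clinearI simp: capply_add capply_scaleC distrib_left mult_scaleC_right)
  show "norm (dual_right l x) \<le> norm l * norm x"
    by (intro norm_cdual_bound) (auto simp: * b)
qed

lemma dual_left_apply: "capply (dual_left x l) y = capply l (y * x)"
  and norm_dual_left: "norm (dual_left x l) \<le> norm l * norm x"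
proof -
  have b: "norm (capply l (y * x)) \<le> norm l * norm x * norm y" for y
    by (rule order_trans[OF norm_capply])
       (simp add: mult.assoc mult_left_mono norm_mult_ineq mult.commute[of "norm x"])
  then show *: "capply (dual_left x l) y = capply l (y * x)" for y
    unfolding dual_left_def
    by (subst capply_CDual)
       (auto intro!: bounded_clinearI simp: capply_add capply_scaleC distrib_right mult_scaleC_left)
  show "norm (dual_left x l) \<le> norm l * norm x"
    by (intro norm_cdual_bound) (auto simp: * b)
qed

lemma dual_right_linear:
  "dual_right l (x + y) = dual_right l x + dual_right l y"
  "dual_right l (c *\<^sub>C x) = c *\<^sub>C dual_right l x"
  "dual_right (l + l') x = dual_right l x + dual_right l' x"
  "dual_right (c *\<^sub>C l) x = c *\<^sub>C dual_right l x"
  by (auto intro!: cdual_eqI simp: dual_right_apply capply_add capply_scaleC capply_add_left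
      capply_scaleC_left distrib_right mult_scaleC_left)

lemma dual_left_linear:
  "dual_left (x + y) l = dual_left x l + dual_left y l"
  "dual_left (c *\<^sub>C x) l = c *\<^sub>C dual_left x l"
  "dual_left x (l + l') = dual_left x l + dual_left x l'"
  "dual_left x (c *\<^sub>C l) = c *\<^sub>C dual_left x l"
  by (auto intro!: cdual_eqI simp: dual_left_apply capply_add capply_scaleC capply_add_left
      capply_scaleC_left distrib_left mult_scaleC_right)

lemma bidual_left_apply: "capply (bidual_left \<Phi> l) x = capply \<Phi> (dual_right l x)"
  and norm_bidual_left: "norm (bidual_left \<Phi> l) \<le> norm \<Phi> * norm l"
proof -
  have b: "norm (capply \<Phi> (dual_right l x)) \<le> norm \<Phi> * norm l * norm x" for x
    by (rule order_trans[OF norm_capply]) (simp add: mult.assoc mult_left_mono norm_dual_right)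
  then show *: "capply (bidual_left \<Phi> l) x = capply \<Phi> (dual_right l x)" for x
    unfolding bidual_left_def
    by (subst capply_CDual)
       (auto intro!: bounded_clinearI simp: capply_add capply_scaleC dual_right_linear)
  show "norm (bidual_left \<Phi> l) \<le> norm \<Phi> * norm l"
    by (intro norm_cdual_bound) (auto simp: * b)
qed

lemma bidual_right_apply: "capply (bidual_right l \<Psi>) x = capply \<Psi> (dual_left x l)"
  and norm_bidual_right: "norm (bidual_right l \<Psi>) \<le> norm \<Psi> * norm l"
proof -
  have b: "norm (capply \<Psi> (dual_left x l)) \<le> norm \<Psi> * norm l * norm x" for x
    by (rule order_trans[OF norm_capply]) (simp add: mult.assoc mult_left_mono norm_dual_left)
  then show *: "capply (bidual_right l \<Psi>) x = capply \<Psi> (dual_left x l)" for x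
    unfolding bidual_right_def
    by (subst capply_CDual)
       (auto intro!: bounded_clinearI simp: capply_add capply_scaleC dual_left_linear)
  show "norm (bidual_right l \<Psi>) \<le> norm \<Psi> * norm l"
    by (intro norm_cdual_bound) (auto simp: * b)
qed

lemma bidual_left_linear:
  "bidual_left \<Phi> (l + l') = bidual_left \<Phi> l + bidual_left \<Phi> l'"
  "bidual_left \<Phi> (c *\<^sub>C l) = c *\<^sub>C bidual_left \<Phi> l"
  by (auto intro!: cdual_eqI simp: bidual_left_apply capply_add capply_scaleC capply_add_left
      capply_scaleC_left dual_right_linear)

lemma bidual_right_linear:
  "bidual_right (l + l') \<Psi> = bidual_right l \<Psi> + bidual_right l' \<Psi>"
  "bidual_right (c *\<^sub>C l) \<Psi> = c *\<^sub>C bidual_right l \<Psi>"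
  by (auto intro!: cdual_eqI simp: bidual_right_apply capply_add capply_scaleC capply_add_left
      capply_scaleC_left dual_left_linear)

lemma arens_box_apply: "capply (\<Psi> \<box> \<Phi>) l = capply \<Psi> (bidual_left \<Phi> l)"
  and norm_arens_box: "norm (\<Psi> \<box> \<Phi>) \<le> norm \<Psi> * norm \<Phi>"
proof -
  have b: "norm (capply \<Psi> (bidual_left \<Phi> l)) \<le> norm \<Psi> * norm \<Phi> * norm l" for l
    by (rule order_trans[OF norm_capply]) (simp add: mult.assoc mult_left_mono norm_bidual_left)
  then show *: "capply (\<Psi> \<box> \<Phi>) l = capply \<Psi> (bidual_left \<Phi> l)" for l
    unfolding arens_box_def
    by (subst capply_CDual)
       (auto intro!: bounded_clinearI simp: capply_add capply_scaleC bidual_left_linear)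
  show "norm (\<Psi> \<box> \<Phi>) \<le> norm \<Psi> * norm \<Phi>"
    by (intro norm_cdual_bound) (auto simp: * b)
qed

lemma arens_diamond_apply: "capply (\<Psi> \<diamondop> \<Phi>) l = capply \<Phi> (bidual_right l \<Psi>)"
  and norm_arens_diamond: "norm (\<Psi> \<diamondop> \<Phi>) \<le> norm \<Psi> * norm \<Phi>"
proof -
  have b: "norm (capply \<Phi> (bidual_right l \<Psi>)) \<le> norm \<Psi> * norm \<Phi> * norm l" for l
    by (rule order_trans[OF norm_capply])
       (metis mult.assoc mult.commute mult_left_mono norm_bidual_right norm_ge_zero)
  then show *: "capply (\<Psi> \<diamondop> \<Phi>) l = capply \<Phi> (bidual_right l \<Psi>)" for l
    unfolding arens_diamond_def
    by (subst capply_CDual)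
       (auto intro!: bounded_clinearI simp: capply_add capply_scaleC bidual_right_linear)
  show "norm (\<Psi> \<diamondop> \<Phi>) \<le> norm \<Psi> * norm \<Phi>"
    by (intro norm_cdual_bound) (auto simp: * b)
qed


section \<open>The Jacobson radical\<close>

text \<open>The product is an explicit argument \<open>m\<close>, since the bidual carries two of them.
  \<open>mpow m x n\<close> is the power \<open>x ^ (n + 1)\<close>.\<close>

primrec mpow :: "('a \<Rightarrow> 'a \<Rightarrow> 'a) \<Rightarrow> 'a \<Rightarrow> nat \<Rightarrow> 'a" where
  "mpow m x 0 = x"
| "mpow m x (Suc n) = m x (mpow m x n)"

definition quasi_nilpotent :: "('a::complex_normed_vector \<Rightarrow> 'a \<Rightarrow> 'a) \<Rightarrow> 'a \<Rightarrow> bool" where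
  "quasi_nilpotent m x \<longleftrightarrow> (\<lambda>n. root (Suc n) (norm (mpow m x n))) \<longlonglongrightarrow> 0"

definition left_ideal :: "('a::complex_normed_vector \<Rightarrow> 'a \<Rightarrow> 'a) \<Rightarrow> 'a set \<Rightarrow> bool" where
  "left_ideal m I \<longleftrightarrow> 0 \<in> I \<and> (\<forall>x\<in>I. \<forall>y\<in>I. x + y \<in> I) \<and> (\<forall>c. \<forall>x\<in>I. c *\<^sub>C x \<in> I) \<and>
     (\<forall>y. \<forall>x\<in>I. m y x \<in> I)"

text \<open>The largest left ideal of quasi-nilpotent elements, as the union of all such ideals.\<close>

definition jacobson_rad :: "('a::complex_normed_vector \<Rightarrow> 'a \<Rightarrow> 'a) \<Rightarrow> 'a set" where
  "jacobson_rad m = \<Union>{I. left_ideal m I \<and> (\<forall>x\<in>I. quasi_nilpotent m x)}"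

lemma jacobson_rad_eq_largest:
  assumes "left_ideal m R" "\<forall>x\<in>R. quasi_nilpotent m x"
    and "\<And>I. left_ideal m I \<Longrightarrow> \<forall>x\<in>I. quasi_nilpotent m x \<Longrightarrow> I \<subseteq> R"
  shows "jacobson_rad m = R"
  using assms unfolding jacobson_rad_def by blast


section \<open>Nets and subnets\<close>

definition directed_set :: "'i set \<Rightarrow> ('i \<Rightarrow> 'i \<Rightarrow> bool) \<Rightarrow> bool" where
  "directed_set D le \<longleftrightarrow> D \<noteq> {} \<and> (\<forall>x\<in>D. le x x) \<and>
     (\<forall>x\<in>D. \<forall>y\<in>D. \<forall>z\<in>D. le x y \<longrightarrow> le y z \<longrightarrow> le x z) \<and>
     (\<forall>x\<in>D. \<forall>y\<in>D. \<exists>z\<in>D. le x z \<and> le y z)"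

definition net_filter :: "'i set \<Rightarrow> ('i \<Rightarrow> 'i \<Rightarrow> bool) \<Rightarrow> 'i filter" where
  "net_filter D le = (INF d\<in>D. principal {e\<in>D. le d e})"

lemma eventually_net_filter:
  assumes "directed_set D le"
  shows "eventually P (net_filter D le) \<longleftrightarrow> (\<exists>d\<in>D. \<forall>e\<in>D. le d e \<longrightarrow> P e)"
  unfolding net_filter_def
proof (subst eventually_INF_base)
  show "\<exists>z\<in>D. principal {e\<in>D. le z e} \<le> inf (principal {e\<in>D. le x e}) (principal {e\<in>D. le y e})"
    if "x \<in> D" "y \<in> D" for x y
  proof -
    have "\<forall>x\<in>D. \<forall>y\<in>D. \<forall>z\<in>D. le x y \<longrightarrow> le y z \<longrightarrow> le x z"
      using assms unfolding directed_set_def by (elim conjE)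
    then have tr: "le u w" if "u \<in> D" "v \<in> D" "w \<in> D" "le u v" "le v w" for u v w
      using that by blast
    have "\<forall>x\<in>D. \<forall>y\<in>D. \<exists>z\<in>D. le x z \<and> le y z"
      using assms unfolding directed_set_def by (elim conjE)
    with that obtain z where z: "z \<in> D" "le x z" "le y z"
      by metis
    have "{e\<in>D. le z e} \<subseteq> {e\<in>D. le x e} \<inter> {e\<in>D. le y e}"
      using z that by (auto intro: tr)
    then show ?thesis
      using z(1) by (intro bexI[of _ z]) simp_all
  qed
  show "D \<noteq> {}"
    using assms unfolding directed_set_def by (elim conjE)
qed (auto simp: eventually_principal)

text \<open>\<open>h\<close> turns nets indexed by \<open>(L, leL)\<close> into subnets indexed by \<open>(D, le)\<close>, in Willard's sense.\<close>

definition subnet_map ::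
    "'i set \<Rightarrow> ('i \<Rightarrow> 'i \<Rightarrow> bool) \<Rightarrow> 'j set \<Rightarrow> ('j \<Rightarrow> 'j \<Rightarrow> bool) \<Rightarrow> ('i \<Rightarrow> 'j) \<Rightarrow> bool" where
  "subnet_map D le L leL h \<longleftrightarrow> directed_set D le \<and> h ` D \<subseteq> L \<and>
     (\<forall>x\<in>D. \<forall>y\<in>D. le x y \<longrightarrow> leL (h x) (h y)) \<and> (\<forall>l\<in>L. \<exists>x\<in>D. leL l (h x))"


section \<open>Free groups\<close>

text \<open>A letter \<open>(x, True)\<close> stands for the generator \<open>x\<close> and \<open>(x, False)\<close> for its inverse.
  The free group consists of the reduced words; multiplication pushes the letters of the first
  word onto the second one, cancelling where possible.\<close>

definition linv :: "'a \<times> bool \<Rightarrow> 'a \<times> bool" where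
  "linv l = (fst l, \<not> snd l)"

lemma linv_linv [simp]: "linv (linv l) = l"
  by (simp add: linv_def)

fun reduced :: "('a \<times> bool) list \<Rightarrow> bool" where
  "reduced [] \<longleftrightarrow> True"
| "reduced [l] \<longleftrightarrow> True"
| "reduced (l # l' # w) \<longleftrightarrow> l' \<noteq> linv l \<and> reduced (l' # w)"

definition push :: "'a \<times> bool \<Rightarrow> ('a \<times> bool) list \<Rightarrow> ('a \<times> bool) list" where
  "push l w = (if w \<noteq> [] \<and> hd w = linv l then tl w else l # w)"

lemma reduced_Cons: "reduced (l # w) \<longleftrightarrow> reduced w \<and> (w = [] \<or> hd w \<noteq> linv l)"
  by (cases w) auto

lemma reduced_push: "reduced w \<Longrightarrow> reduced (push l w)"
  by (cases w) (auto simp: push_def reduced_Cons)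

lemma reduced_foldr_push: "reduced w \<Longrightarrow> reduced (foldr push u w)"
  by (induction u) (auto intro: reduced_push)

lemma push_push: "reduced w \<Longrightarrow> push l (push (linv l) w) = w"
  by (cases w; cases "tl w") (auto simp: push_def reduced_Cons)

lemma foldr_push_push:
  assumes "reduced w" "reduced u"
  shows "foldr push (push l u) w = push l (foldr push u w)"
proof (cases "u \<noteq> [] \<and> hd u = linv l")
  case True
  then obtain u' where u: "u = linv l # u'" by (metis list.collapse)
  have "push l u = u'" by (simp add: u push_def)
  then show ?thesis
    using push_push[OF reduced_foldr_push[OF assms(1), of u'], of l] by (simp add: u)
next
  case False
  then have "push l u = l # u" by (auto simp only: push_def if_False)
  then show ?thesis by simp
qed

lemma foldr_push_assoc:
  "reduced w \<Longrightarrow> reduced v \<Longrightarrow> foldr push (foldr push u v) w = foldr push u (foldr push v w)"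
  by (induction u) (auto simp: foldr_push_push reduced_foldr_push)

lemma foldr_push_Nil: "reduced u \<Longrightarrow> foldr push u [] = u"
  by (induction u) (auto simp: push_def reduced_Cons)

lemma reduced_append_single:
  "reduced (w @ [l]) \<longleftrightarrow> reduced w \<and> (w = [] \<or> l \<noteq> linv (last w))"
  by (induction w rule: reduced.induct) auto

lemma reduced_rev: "reduced w \<Longrightarrow> reduced (rev (map linv w))"
  by (induction w) (auto simp: reduced_append_single reduced_Cons last_rev hd_map)

lemma foldr_push_inverse: "reduced w \<Longrightarrow> foldr push u (foldr push (rev (map linv u)) w) = w"
  by (induction u arbitrary: w) (auto simp: push_push reduced_push)

typedef 'a free_group = "{w :: ('a \<times> bool) list. reduced w}"
  by (intro exI[of _ "[]"]) simp

setup_lifting type_definition_free_group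

instantiation free_group :: (type) "{monoid_mult, inverse}"
begin

lift_definition one_free_group :: "'a free_group" is "[]" by simp

lift_definition times_free_group :: "'a free_group \<Rightarrow> 'a free_group \<Rightarrow> 'a free_group"
  is "foldr push" by (rule reduced_foldr_push)

lift_definition inverse_free_group :: "'a free_group \<Rightarrow> 'a free_group"
  is "\<lambda>w. rev (map linv w)" by (rule reduced_rev)

definition divide_free_group :: "'a free_group \<Rightarrow> 'a free_group \<Rightarrow> 'a free_group" where
  "divide_free_group x y = x * inverse y"

instance
  by standard (transfer; simp add: foldr_push_assoc foldr_push_Nil)+

end

lemma fg_right_inverse: "x * inverse x = (1 :: 'a free_group)"
  by transfer (metis foldr_push_Nil foldr_push_inverse reduced.simps(1) reduced_rev)

lemma fg_left_inverse: "inverse x * x = (1 :: 'a free_group)"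
  by (metis fg_right_inverse mult.assoc mult.right_neutral mult.left_neutral)

lift_definition fg_gen :: "'a \<Rightarrow> 'a free_group" is "\<lambda>x. [(x, True)]" by simp


section \<open>The weight on the free group of rank three\<close>

datatype gen3 = GA | GB | GC

type_synonym F3 = "gen3 free_group"

abbreviation ga :: F3 where "ga \<equiv> fg_gen GA"
abbreviation gb :: F3 where "gb \<equiv> fg_gen GB"
abbreviation gc :: F3 where "gc \<equiv> fg_gen GC"

text \<open>Junk value if \<open>g\<close> is not a product of elements of \<open>T\<close>; \<open>T\<close> need not be symmetric.\<close>

definition word_length :: "'a::monoid_mult set \<Rightarrow> 'a \<Rightarrow> nat" where
  "word_length T g = (LEAST n. \<exists>ws. length ws = n \<and> set ws \<subseteq> T \<and> prod_list ws = g)"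

definition S3 :: "F3 set" where
  "S3 = {ga, gb, gc, inverse ga, inverse gb, inverse gc}"

definition xelem :: "F3 \<Rightarrow> nat \<Rightarrow> F3" where
  "xelem v j = v * gb ^ (5 ^ (2 * j - 1)) * inverse v * ga ^ (5 ^ (2 * j)) * gb ^ (5 ^ (2 * j))"

definition Xj :: "nat \<Rightarrow> F3 set" where
  "Xj j = {xelem v j | v. word_length S3 v \<le> 5 ^ j}"

definition X3 :: "F3 set" where
  "X3 = (\<Union>j\<in>{2..}. Xj j) \<union> S3"

definition \<omega> :: "F3 \<Rightarrow> real" where
  "\<omega> t = exp (real (word_length X3 t))"

lemma word_length_le:
  "set ws \<subseteq> T \<Longrightarrow> word_length T (prod_list ws) \<le> length ws"
  unfolding word_length_def by (intro Least_le) auto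

lemma word_length_one: "word_length T 1 = 0"
  using word_length_le[of "[]" T] by simp

lemma word_length_wit:
  assumes "set ws \<subseteq> T" "prod_list ws = g"
  obtains us where "set us \<subseteq> T" "prod_list us = g" "length us = word_length T g"
proof -
  let ?P = "\<lambda>n. \<exists>us. length us = n \<and> set us \<subseteq> T \<and> prod_list us = g"
  have "?P (LEAST n. ?P n)"
    by (rule LeastI[of ?P "length ws"]) (intro exI[of _ ws] conjI refl assms)
  then obtain us where "length us = (LEAST n. ?P n)" "set us \<subseteq> T" "prod_list us = g"
    by (elim exE conjE)
  then show ?thesis by (intro that[of us]) (simp_all only: word_length_def)
qed

lemma S3_generates: "\<exists>ws. set ws \<subseteq> S3 \<and> prod_list ws = g"
proof -
  have fg: "Abs_free_group [l] \<in> S3" for l :: "gen3 \<times> bool"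
  proof -
    obtain x s where "l = (x, s)" by fastforce
    moreover have "inverse (fg_gen x) = Abs_free_group [(x, False)]" for x :: gen3
      by (simp add: inverse_free_group_def fg_gen.rep_eq linv_def)
    ultimately show ?thesis
      by (cases x; cases s) (auto simp: S3_def fg_gen_def)
  qed
  have "reduced w \<Longrightarrow> \<exists>ws. set ws \<subseteq> S3 \<and> prod_list ws = Abs_free_group w" for w
  proof (induction w)
    case Nil
    then show ?case by (intro exI[of _ "[]"]) (simp add: one_free_group_def)
  next
    case (Cons l w)
    then obtain ws where ws: "set ws \<subseteq> S3" "prod_list ws = Abs_free_group w"
      by (auto simp: reduced_Cons)
    have "Abs_free_group [l] * Abs_free_group w = Abs_free_group (l # w)"
      using Cons.prems
      by (simp add: times_free_group_def Abs_free_group_inverse reduced_Cons)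
        (auto simp: push_def)
    with ws fg[of l] show ?case by (intro exI[of _ "Abs_free_group [l] # ws"]) auto
  qed
  from this[of "Rep_free_group g"] show ?thesis
    using Rep_free_group[of g] by (simp add: Rep_free_group_inverse)
qed

lemma X3_generates: "\<exists>ws. set ws \<subseteq> X3 \<and> prod_list ws = g"
  using S3_generates[of g] unfolding X3_def by blast

lemma word_length_mult: "word_length X3 (s * t) \<le> word_length X3 s + word_length X3 t"
proof -
  obtain us where "set us \<subseteq> X3" "prod_list us = s" "length us = word_length X3 s"
    using X3_generates[of s] word_length_wit by metis
  moreover obtain vs where "set vs \<subseteq> X3" "prod_list vs = t" "length vs = word_length X3 t"
    using X3_generates[of t] word_length_wit by metis
  ultimately show ?thesis using word_length_le[of "us @ vs" X3] by simp
qed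

lemma \<omega>_one: "\<omega> 1 = 1"
  by (simp add: \<omega>_def word_length_one)

lemma \<omega>_mult: "\<omega> (s * t) \<le> \<omega> s * \<omega> t"
  unfolding \<omega>_def exp_add[symmetric] using word_length_mult[of s t] by simp

lemma \<omega>_ge_1: "1 \<le> \<omega> t"
  by (simp add: \<omega>_def)

lemma \<omega>_pos [simp]: "0 < \<omega> t" "0 \<le> \<omega> t"
  by (simp_all add: \<omega>_def)


section \<open>The Beurling algebra\<close>

typedef beurling = "{f :: F3 \<Rightarrow> complex. (\<lambda>t. norm (f t) * \<omega> t) summable_on UNIV}"
  morphisms bcoeff Beurling
  by (intro exI[of _ "\<lambda>_. 0"]) simp

setup_lifting type_definition_beurling

definition conv :: "(F3 \<Rightarrow> complex) \<Rightarrow> (F3 \<Rightarrow> complex) \<Rightarrow> F3 \<Rightarrow> complex" where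
  "conv f g t = (\<Sum>\<^sub>\<infinity>s. f s * g (inverse s * t))"

abbreviation wsummable :: "(F3 \<Rightarrow> complex) \<Rightarrow> bool" where
  "wsummable f \<equiv> (\<lambda>t. norm (f t) * \<omega> t) summable_on UNIV"

definition wnorm :: "(F3 \<Rightarrow> complex) \<Rightarrow> real" where
  "wnorm f = (\<Sum>\<^sub>\<infinity>t. norm (f t) * \<omega> t)"

lemma wsummable_comparison:
  assumes "wsummable g" "\<And>t. norm (f t) \<le> norm (g t)"
  shows "wsummable f"
  by (rule summable_on_comparison_test[OF assms(1)]) (auto intro: mult_right_mono assms)

lemma wsummable_add:
  assumes "wsummable f" "wsummable g"
  shows "wsummable (\<lambda>t. f t + g t)" "wnorm (\<lambda>t. f t + g t) \<le> wnorm f + wnorm g"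
proof -
  have le: "norm (f t + g t) * \<omega> t \<le> norm (f t) * \<omega> t + norm (g t) * \<omega> t" for t
    by (metis \<omega>_pos(2) distrib_right mult_right_mono norm_triangle_ineq)
  have s: "(\<lambda>t. norm (f t) * \<omega> t + norm (g t) * \<omega> t) summable_on UNIV"
    by (rule summable_on_add[OF assms])
  show *: "wsummable (\<lambda>t. f t + g t)"
    by (rule summable_on_comparison_test[OF s]) (auto simp: le)
  show "wnorm (\<lambda>t. f t + g t) \<le> wnorm f + wnorm g"
    unfolding wnorm_def infsum_add[OF assms, symmetric]
    by (rule infsum_mono[OF * s]) (rule le)
qed

lemma wsummable_cmult:
  assumes "wsummable f"
  shows "wsummable (\<lambda>t. c * f t)" "wnorm (\<lambda>t. c * f t) = norm c * wnorm f"
  using summable_on_cmult_right[OF assms, of "norm c"]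
  by (simp_all add: wnorm_def norm_mult mult.assoc infsum_cmult_right')

lemma wnorm_nonneg: "0 \<le> wnorm f"
  unfolding wnorm_def by (intro infsum_nonneg) simp

lemma norm_le_wnorm:
  assumes "wsummable f"
  shows "norm (f t) * \<omega> t \<le> wnorm f" "norm (f t) \<le> wnorm f"
proof -
  show *: "norm (f t) * \<omega> t \<le> wnorm f"
    using finite_sum_le_infsum[OF assms, of "{t}"] by (simp add: wnorm_def)
  have "norm (f t) * 1 \<le> norm (f t) * \<omega> t"
    by (intro mult_left_mono \<omega>_ge_1) simp
  with * show "norm (f t) \<le> wnorm f" by simp
qed

lemma shear_bij: "bij (\<lambda>(s, t). (s, inverse s * t :: 'a free_group))"
  by (rule bij_betw_byWitness[where f' = "\<lambda>(s, u). (s, s * u)"])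
     (auto simp: mult.assoc[symmetric] fg_right_inverse fg_left_inverse)

lemma left_mult_bij: "bij (\<lambda>t :: 'a free_group. inverse s * t)"
  by (rule bij_betw_byWitness[where f' = "\<lambda>u. s * u"])
     (auto simp: mult.assoc[symmetric] fg_right_inverse fg_left_inverse)

lemma conv_joint:
  assumes f: "wsummable f" and g: "wsummable g"
  shows conv_joint_weighted:
      "(\<lambda>(s, t). norm (f s * g (inverse s * t)) * (\<omega> s * \<omega> (inverse s * t))) summable_on UNIV"
    and conv_joint_weighted_infsum:
      "(\<Sum>\<^sub>\<infinity>(s, t). norm (f s * g (inverse s * t)) * (\<omega> s * \<omega> (inverse s * t))) = wnorm f * wnorm g"
    and conv_joint_summable: "(\<lambda>(s, t). norm (f s * g (inverse s * t)) * \<omega> t) summable_on UNIV"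
    and conv_joint_le: "(\<Sum>\<^sub>\<infinity>(s, t). norm (f s * g (inverse s * t)) * \<omega> t) \<le> wnorm f * wnorm g"
proof -
  let ?F = "\<lambda>(s, u). (norm (f s) * \<omega> s) * (norm (g u) * \<omega> u)"
  let ?G = "\<lambda>(s, t). norm (f s * g (inverse s * t)) * (\<omega> s * \<omega> (inverse s * t))"
  let ?H = "\<lambda>(s, t). norm (f s * g (inverse s * t)) * \<omega> t"
  have G: "?G = (\<lambda>p. ?F ((\<lambda>(s, t). (s, inverse s * t)) p))"
    by (auto simp: norm_mult fun_eq_iff)
  have "?F summable_on (UNIV \<times> UNIV)"
    by (rule summable_on_SigmaI[where g = "\<lambda>s. (norm (f s) * \<omega> s) * wnorm g"])
       (use f g in \<open>auto simp: wnorm_def intro!: has_sum_cmult_right summable_on_cmult_left\<close>)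
  then have F: "?F summable_on UNIV" by simp
  show sG: "?G summable_on UNIV"
    unfolding G by (subst summable_on_reindex_bij_betw[OF shear_bij]) (rule F)
  have "infsum ?F UNIV = (\<Sum>\<^sub>\<infinity>s. \<Sum>\<^sub>\<infinity>u. (norm (f s) * \<omega> s) * (norm (g u) * \<omega> u))"
    using infsum_Sigma'_banach[of "\<lambda>s u. (norm (f s) * \<omega> s) * (norm (g u) * \<omega> u)" UNIV "\<lambda>_. UNIV"] F
    by simp
  also have "\<dots> = wnorm f * wnorm g"
    by (simp add: infsum_cmult_right' infsum_cmult_left' wnorm_def)
  finally show iG: "infsum ?G UNIV = wnorm f * wnorm g"
    unfolding G by (subst infsum_reindex_bij_betw[OF shear_bij])
  have le: "?H p \<le> ?G p" for p
  proof (cases p)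
    case (Pair s t)
    have "\<omega> t \<le> \<omega> s * \<omega> (inverse s * t)"
      using \<omega>_mult[of s "inverse s * t"] by (simp add: mult.assoc[symmetric] fg_right_inverse)
    then show ?thesis using Pair by (auto intro: mult_left_mono)
  qed
  show sH: "?H summable_on UNIV"
    by (rule summable_on_comparison_test[OF sG]) (use le in auto)
  show "infsum ?H UNIV \<le> wnorm f * wnorm g"
    unfolding iG[symmetric] by (rule infsum_mono[OF sH sG]) (rule le)
qed

lemma conv_joint_abs:
  assumes f: "wsummable f" and g: "wsummable g"
  shows "(\<lambda>p. norm (case p of (s, t) \<Rightarrow> f s * g (inverse s * t))) summable_on UNIV"
proof (rule summable_on_comparison_test[OF conv_joint_summable[OF assms]], goal_cases)
  case (1 p)
  then show ?case
    using mult_left_mono[OF \<omega>_ge_1, of "norm (f (fst p) * g (inverse (fst p) * snd p))" "snd p"]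
    by (simp add: case_prod_unfold)
qed simp

lemma conv_abs_summable:
  assumes f: "wsummable f" and g: "wsummable g"
  shows "(\<lambda>s. norm (f s * g (inverse s * t))) summable_on UNIV"
proof -
  have "(\<lambda>(t, s). norm (f s * g (inverse s * t))) summable_on (UNIV \<times> UNIV)"
    using conv_joint_abs[OF assms]
    by (subst summable_on_swap) (simp add: case_prod_unfold)
  from summable_on_SigmaD1[OF this, of t] show ?thesis by simp
qed

lemma conv_summable:
  assumes "wsummable f" "wsummable g"
  shows "(\<lambda>s. f s * g (inverse s * t)) summable_on UNIV"
  using conv_abs_summable[OF assms] by (rule abs_summable_summable)

lemma wsummable_conv:
  assumes f: "wsummable f" and g: "wsummable g"
  shows "wsummable (conv f g)" "wnorm (conv f g) \<le> wnorm f * wnorm g"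
proof -
  let ?h = "\<lambda>t s. norm (f s * g (inverse s * t)) * \<omega> t"
  have j: "(\<lambda>(t, s). ?h t s) summable_on (UNIV \<times> UNIV)"
    using conv_joint_summable[OF assms]
    by (subst summable_on_swap) (simp add: case_prod_unfold)
  have s: "(\<lambda>t. \<Sum>\<^sub>\<infinity>s. ?h t s) summable_on UNIV"
    using summable_on_Sigma_banach[OF j] by simp
  have le: "norm (conv f g t) * \<omega> t \<le> (\<Sum>\<^sub>\<infinity>s. ?h t s)" for t
    unfolding conv_def infsum_cmult_left'
    by (intro mult_right_mono norm_infsum_bound conv_abs_summable assms) simp
  show *: "wsummable (conv f g)"
    by (rule summable_on_comparison_test[OF s]) (auto simp: le)
  have "wnorm (conv f g) \<le> (\<Sum>\<^sub>\<infinity>t. \<Sum>\<^sub>\<infinity>s. ?h t s)"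
    unfolding wnorm_def by (rule infsum_mono[OF * s]) (rule le)
  also have "\<dots> = (\<Sum>\<^sub>\<infinity>s. \<Sum>\<^sub>\<infinity>t. ?h t s)"
    by (rule infsum_swap_banach) (use j in simp)
  also have "\<dots> = (\<Sum>\<^sub>\<infinity>(s, t). ?h t s)"
    using infsum_Sigma'_banach[of "\<lambda>s t. ?h t s" UNIV "\<lambda>_. UNIV"] conv_joint_summable[OF assms]
    by simp
  also have "\<dots> \<le> wnorm f * wnorm g"
    by (rule conv_joint_le[OF assms])
  finally show "wnorm (conv f g) \<le> wnorm f * wnorm g" .
qed

lemma conv_assoc:
  assumes f: "wsummable f" and g: "wsummable g" and h: "wsummable h"
  shows "conv (conv f g) h = conv f (conv g h)"
proof
  fix t
  let ?k = "\<lambda>s r. f s * g (inverse s * r) * h (inverse r * t)"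
  have abs: "(\<lambda>p. norm (case p of (s, r) \<Rightarrow> ?k s r)) summable_on (UNIV \<times> UNIV)"
  proof (rule summable_on_comparison_test)
    show "(\<lambda>p. norm (case p of (s, r) \<Rightarrow> f s * g (inverse s * r)) * wnorm h) summable_on (UNIV \<times> UNIV)"
      using summable_on_cmult_left[OF conv_joint_abs[OF f g], of "wnorm h"] by simp
  qed (auto simp: norm_mult intro!: mult_left_mono norm_le_wnorm h)
  then have sum: "(\<lambda>(s, r). ?k s r) summable_on (UNIV \<times> UNIV)"
    by (rule abs_summable_summable)
  have "conv (conv f g) h t = (\<Sum>\<^sub>\<infinity>r. \<Sum>\<^sub>\<infinity>s. ?k s r)"
    by (simp add: conv_def infsum_cmult_left')
  also have "\<dots> = (\<Sum>\<^sub>\<infinity>s. \<Sum>\<^sub>\<infinity>r. ?k s r)"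
    by (rule infsum_swap_banach[OF sum, symmetric])
  also have "\<dots> = (\<Sum>\<^sub>\<infinity>s. f s * conv g h (inverse s * t))"
  proof (rule infsum_cong)
    fix s
    have "(\<Sum>\<^sub>\<infinity>r. ?k s r) = (\<Sum>\<^sub>\<infinity>r. f s * (g (inverse s * r) * h (inverse (inverse s * r) * (inverse s * t))))"
    proof (rule infsum_cong)
      fix r
      have "inverse (inverse s * r) * (inverse s * t) = inverse r * t"
      proof -
        have "inverse s * r * (inverse r * t) = inverse s * t"
          by (metis fg_right_inverse mult.assoc mult.left_neutral)
        then show ?thesis
          by (metis fg_left_inverse mult.assoc mult.left_neutral)
      qed
      then show "?k s r = f s * (g (inverse s * r) * h (inverse (inverse s * r) * (inverse s * t)))"
        by (simp add: mult.assoc)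
    qed
    also have "\<dots> = (\<Sum>\<^sub>\<infinity>u. f s * (g u * h (inverse u * (inverse s * t))))"
      using infsum_reindex_bij_betw[OF left_mult_bij[of s],
          of "\<lambda>u. f s * (g u * h (inverse u * (inverse s * t)))"] by simp
    also have "\<dots> = f s * conv g h (inverse s * t)"
      by (simp add: conv_def infsum_cmult_right')
    finally show "(\<Sum>\<^sub>\<infinity>r. ?k s r) = f s * conv g h (inverse s * t)" .
  qed
  finally show "conv (conv f g) h t = conv f (conv g h) t"
    by (simp add: conv_def)
qed

lemma conv_linear:
  assumes "wsummable f" "wsummable f'" "wsummable g" "wsummable g'"
  shows "conv (\<lambda>t. f t + f' t) g = (\<lambda>t. conv f g t + conv f' g t)"
    "conv f (\<lambda>t. g t + g' t) = (\<lambda>t. conv f g t + conv f g' t)"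
    "conv (\<lambda>t. c * f t) g = (\<lambda>t. c * conv f g t)"
    "conv f (\<lambda>t. c * g t) = (\<lambda>t. c * conv f g t)"
proof -
  note s = conv_summable[OF assms(1,3)] conv_summable[OF assms(2,3)] conv_summable[OF assms(1,4)]
  show "conv (\<lambda>t. f t + f' t) g = (\<lambda>t. conv f g t + conv f' g t)"
    by (simp add: fun_eq_iff conv_def distrib_right infsum_add s)
  show "conv f (\<lambda>t. g t + g' t) = (\<lambda>t. conv f g t + conv f g' t)"
    by (simp add: fun_eq_iff conv_def distrib_left infsum_add s)
  show "conv (\<lambda>t. c * f t) g = (\<lambda>t. c * conv f g t)"
    by (simp add: fun_eq_iff conv_def mult.assoc infsum_cmult_right')
  show "conv f (\<lambda>t. c * g t) = (\<lambda>t. c * conv f g t)"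
    by (simp add: fun_eq_iff conv_def mult.left_commute infsum_cmult_right')
qed

instantiation beurling :: complex_normed_algebra
begin

lift_definition norm_beurling :: "beurling \<Rightarrow> real" is "\<lambda>f. \<Sum>\<^sub>\<infinity>t. norm (f t) * \<omega> t" .

lift_definition zero_beurling :: beurling is "\<lambda>_. 0" by simp

lift_definition plus_beurling :: "beurling \<Rightarrow> beurling \<Rightarrow> beurling" is "\<lambda>f g t. f t + g t"
  by (rule wsummable_add)

lift_definition uminus_beurling :: "beurling \<Rightarrow> beurling" is "\<lambda>f t. - f t" by simp

lift_definition minus_beurling :: "beurling \<Rightarrow> beurling \<Rightarrow> beurling" is "\<lambda>f g t. f t - g t"
  subgoal for f g using wsummable_add(1)[of f "\<lambda>t. - g t"] by simp
  done

lift_definition scaleR_beurling :: "real \<Rightarrow> beurling \<Rightarrow> beurling" is "\<lambda>r f t. of_real r * f t"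
  by (rule wsummable_cmult)

lift_definition scaleC_beurling :: "complex \<Rightarrow> beurling \<Rightarrow> beurling" is "\<lambda>c f t. c * f t"
  by (rule wsummable_cmult)

lift_definition times_beurling :: "beurling \<Rightarrow> beurling \<Rightarrow> beurling" is conv
  by (rule wsummable_conv)

definition dist_beurling :: "beurling \<Rightarrow> beurling \<Rightarrow> real"
  where "dist_beurling f g = norm (f - g)"

definition [code del]:
  "(uniformity :: (beurling \<times> beurling) filter) = (INF e\<in>{0 <..}. principal {(x, y). dist x y < e})"

definition open_beurling :: "beurling set \<Rightarrow> bool"
  where [code del]: "open_beurling S = (\<forall>x\<in>S. \<forall>\<^sub>F (x', y) in uniformity. x' = x \<longrightarrow> y \<in> S)"

definition sgn_beurling :: "beurling \<Rightarrow> beurling"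
  where "sgn_beurling x = scaleR (inverse (norm x)) x"

instance
proof
  fix f g h :: beurling and c d :: complex and r :: real
  show "norm (f + g) \<le> norm f + norm g"
    by transfer (rule wsummable_add(2)[unfolded wnorm_def])
  show "norm (r *\<^sub>R f) = \<bar>r\<bar> * norm f"
    by transfer (simp add: wsummable_cmult(2)[unfolded wnorm_def])
  show "norm (c *\<^sub>C f) = norm c * norm f"
    by transfer (simp add: wsummable_cmult(2)[unfolded wnorm_def])
  show "norm (f * g) \<le> norm f * norm g"
    by transfer (rule wsummable_conv(2)[unfolded wnorm_def])
  show "norm f = 0 \<longleftrightarrow> f = 0"
  proof transfer
    fix f :: "F3 \<Rightarrow> complex" assume f: "wsummable f"
    have "f t = 0" if "(\<Sum>\<^sub>\<infinity>t. norm (f t) * \<omega> t) = 0" for t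
      using norm_le_wnorm(2)[OF f, of t] that by (simp add: wnorm_def)
    then have "f = (\<lambda>_. 0)" if "(\<Sum>\<^sub>\<infinity>t. norm (f t) * \<omega> t) = 0"
      using that by (intro ext)
    moreover have "(\<Sum>\<^sub>\<infinity>t. norm (f t) * \<omega> t) = 0" if "f = (\<lambda>_. 0)"
      by (simp add: that)
    ultimately show "(\<Sum>\<^sub>\<infinity>t. norm (f t) * \<omega> t) = 0 \<longleftrightarrow> f = (\<lambda>_. 0)"
      by (rule iffI)
  qed
  show "f * g * h = f * (g * h)" by transfer (rule conv_assoc)
  show "(f + g) * h = f * h + g * h" by transfer (rule conv_linear)
  show "f * (g + h) = f * g + f * h" by transfer (rule conv_linear)
  show "(c *\<^sub>C f) * g = c *\<^sub>C (f * g)" by transfer (rule conv_linear)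
  show "f * (c *\<^sub>C g) = c *\<^sub>C (f * g)" by transfer (rule conv_linear)
  show "(r *\<^sub>R f) * g = r *\<^sub>R (f * g)" by transfer (rule conv_linear)
  show "f * (r *\<^sub>R g) = r *\<^sub>R (f * g)" by transfer (rule conv_linear)
qed (simp only: dist_beurling_def open_beurling_def sgn_beurling_def uniformity_beurling_def
    | (transfer; simp add: algebra_simps))+

end

instance beurling :: banach
proof
  fix X :: "nat \<Rightarrow> beurling"
  assume X: "Cauchy X"
  define x where "x n = bcoeff (X n)" for n
  have x: "wsummable (x n)" for n
    using bcoeff[of "X n"] by (simp add: x_def)
  have nrm: "norm (X n - X m) = wnorm (\<lambda>t. x n t - x m t)" for n m
    by (simp add: norm_beurling.rep_eq minus_beurling.rep_eq wnorm_def x_def)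
  have xd: "wsummable (\<lambda>t. x n t - x m t)" for n m
    using bcoeff[of "X n - X m"] by (simp add: minus_beurling.rep_eq x_def)
  have "Cauchy (\<lambda>n. x n t)" for t
  proof (rule CauchyI)
    fix e :: real assume "0 < e"
    then obtain M where "\<forall>m\<ge>M. \<forall>n\<ge>M. norm (X m - X n) < e" using CauchyD[OF X] by blast
    then show "\<exists>M. \<forall>m\<ge>M. \<forall>n\<ge>M. norm (x m t - x n t) < e"
      using norm_le_wnorm(2)[OF xd, of _ t] unfolding nrm by (meson le_less_trans)
  qed
  then obtain l where l: "\<And>t. (\<lambda>n. x n t) \<longlonglongrightarrow> l t"
    unfolding Cauchy_convergent_iff convergent_def by metis
  have key: "wsummable (\<lambda>t. x n t - l t) \<and> wnorm (\<lambda>t. x n t - l t) \<le> e"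
    if n: "\<forall>m\<ge>M. norm (X n - X m) \<le> e" for n M e
  proof -
    have fin: "(\<Sum>t\<in>F. norm (x n t - l t) * \<omega> t) \<le> e" if "finite F" for F
    proof (rule LIMSEQ_le_const2)
      show "(\<lambda>m. \<Sum>t\<in>F. norm (x n t - x m t) * \<omega> t) \<longlonglongrightarrow> (\<Sum>t\<in>F. norm (x n t - l t) * \<omega> t)"
        by (intro tendsto_intros l)
      show "\<exists>N. \<forall>m\<ge>N. (\<Sum>t\<in>F. norm (x n t - x m t) * \<omega> t) \<le> e"
      proof (intro exI allI impI)
        fix m assume "m \<ge> M"
        have "(\<Sum>t\<in>F. norm (x n t - x m t) * \<omega> t) \<le> wnorm (\<lambda>t. x n t - x m t)"
          unfolding wnorm_def by (rule finite_sum_le_infsum[OF xd]) (auto simp: that)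
        also have "\<dots> \<le> e" using n \<open>m \<ge> M\<close> by (simp add: nrm)
        finally show "(\<Sum>t\<in>F. norm (x n t - x m t) * \<omega> t) \<le> e" .
      qed
    qed
    have s: "wsummable (\<lambda>t. x n t - l t)"
      by (rule nonneg_bdd_above_summable_on) (auto intro!: bdd_aboveI[of _ e] fin)
    moreover have "wnorm (\<lambda>t. x n t - l t) \<le> e"
      unfolding wnorm_def by (rule infsum_le_finite_sums[OF s]) (rule fin)
    ultimately show ?thesis by blast
  qed
  have ev: "\<exists>M. \<forall>n\<ge>M. wsummable (\<lambda>t. x n t - l t) \<and> wnorm (\<lambda>t. x n t - l t) \<le> e"
    if "0 < e" for e
  proof -
    obtain M where M: "\<forall>m\<ge>M. \<forall>n\<ge>M. norm (X m - X n) < e" using CauchyD[OF X \<open>0 < e\<close>] by blast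
    have "wsummable (\<lambda>t. x n t - l t) \<and> wnorm (\<lambda>t. x n t - l t) \<le> e" if "n \<ge> M" for n
      by (rule key[of M]) (use M that in \<open>auto intro: less_imp_le\<close>)
    then show ?thesis by blast
  qed
  obtain M where "wsummable (\<lambda>t. x M t - l t)" using ev[of 1] by auto
  from wsummable_add(1)[OF x[of M] wsummable_cmult(1)[OF this, of "-1"]]
  have lw: "wsummable l" by simp
  have nL: "norm (X n - Beurling l) = wnorm (\<lambda>t. x n t - l t)" for n
    using lw by (simp add: norm_beurling.rep_eq minus_beurling.rep_eq wnorm_def x_def
        Beurling_inverse)
  have "X \<longlonglongrightarrow> Beurling l"
    unfolding LIMSEQ_iff nL
  proof (intro allI impI)
    fix e :: real assume "0 < e"
    then obtain M where "\<forall>n\<ge>M. wnorm (\<lambda>t. x n t - l t) \<le> e / 2" using ev[of "e / 2"] by auto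
    with \<open>0 < e\<close> show "\<exists>M. \<forall>n\<ge>M. wnorm (\<lambda>t. x n t - l t) < e"
      by (intro exI[of _ M]) (auto intro: le_less_trans)
  qed
  then show "convergent X" by (auto simp: convergent_def)
qed

definition pmass :: "F3 \<Rightarrow> beurling" where
  "pmass u = Beurling (\<lambda>t. if t = u then 1 else 0)"

lemma bcoeff_pmass: "bcoeff (pmass u) = (\<lambda>t. if t = u then 1 else 0)"
  unfolding pmass_def
proof (rule Beurling_inverse, rule CollectI)
  show "wsummable (\<lambda>t. if t = u then 1 else 0)"
    by (rule finite_nonzero_values_imp_summable_on) (rule finite_subset[of _ "{u}"], auto)
qed

definition gseq :: "nat \<Rightarrow> beurling" where
  "gseq k = (let u = ga ^ (5 ^ (2 * k)) * gb ^ (5 ^ (2 * k))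
             in complex_of_real (1 / \<omega> u) *\<^sub>C pmass u)"

end

theory Submission
  imports Defs "HOL-Library.Sublist"
begin

text \<open>Write \<open>K = 25^k\<close>, \<open>m\<^sub>k = 5^(2k-1) = K/5\<close> and \<open>p\<^sub>k = a^K b^K\<close>, and let \<open>|g|\<close> be the length of
  \<open>g\<close> with respect to \<open>X\<close>. Everything rests on the identity
  \<open>t p\<^sub>k = b^(-m\<^sub>k) t x(t\<^sup>-\<^sup>1, k)\<close>, in which \<open>t\<close> is any element of \<open>S\<close>-length at most \<open>5^k\<close>: the
  element \<open>p\<^sub>k\<close> costs about \<open>m\<^sub>k\<close> because of a factor \<open>b^(-m\<^sub>k)\<close>, and this factor can be paid for
  anywhere within distance \<open>5^k\<close> to the left of \<open>p\<^sub>k\<close>.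

  In the product \<open>\<Phi>\<^sub>0 \<box> \<Psi> \<box> \<Phi>\<^sub>0\<close> one meets elements \<open>p\<^sub>k t p\<^sub>l\<close> where \<open>l\<close> tends to infinity first. The
  factor \<open>b^(-m\<^sub>l)\<close> of \<open>p\<^sub>l\<close> then slides to the left across \<open>t\<close> and cancels the block \<open>b^(25^k)\<close> of
  \<open>p\<^sub>k\<close>, so that \<open>|p\<^sub>k t p\<^sub>l| \<le> |t| + m\<^sub>l + 1\<close> (\<open>word_length_pk_mult_pk_le\<close>), whereas
  \<open>|p\<^sub>k| + |t| + |p\<^sub>l|\<close> is at least \<open>m\<^sub>k + |t| + m\<^sub>l\<close>. The quotient of the weights is at most
  \<open>exp (1 - m\<^sub>k)\<close>, hence \<open>\<Phi>\<^sub>0 \<box> \<Psi> \<box> \<Phi>\<^sub>0 = 0\<close> (\<open>box_sandwich_eq_0\<close>), and the elements \<open>\<Psi> \<box> \<Phi>\<^sub>0\<close>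
  form a left ideal of elements of square zero that contains \<open>\<Phi>\<^sub>0\<close>.

  For \<open>\<diamondop>\<close> the limits are taken in the opposite order. Let \<open>\<Psi>\<close> be a weak* cluster point of the
  normalized point masses at \<open>c^n\<close>. The powers of \<open>\<Psi> \<diamondop> \<Phi>\<^sub>0\<close> are iterated limits of normalized point
  masses at \<open>c^N\<^sub>1 p\<^sub>k\<^sub>1 c^N\<^sub>2 p\<^sub>k\<^sub>2 \<dots>\<close> in which every \<open>N\<^sub>i\<close> is large compared with everything to its
  right. No factor \<open>b^(-m)\<close> can slide across such a power of \<open>c\<close>, and the lengths add up to within
  \<open>1\<close> per factor (\<open>tower_le_word_length\<close>). Hence the \<open>n\<close>-th power of \<open>\<Psi> \<diamondop> \<Phi>\<^sub>0\<close> has norm at least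
  \<open>exp (- n)\<close>, and \<open>\<Psi> \<diamondop> \<Phi>\<^sub>0\<close> is not quasi-nilpotent although it lies in every left ideal
  that contains \<open>\<Phi>\<^sub>0\<close>.

  Both halves need lower bounds for \<open>|\<gamma>|\<close>. They come from a potential on the group, namely five
  times the homomorphism with values \<open>1, -1, 1\<close> on \<open>a, b, c\<close>, plus the number of letters \<open>b\<close> on the
  part of the geodesic from the identity to \<open>\<gamma>\<close> that has been covered. Multiplication by \<open>x(v,j)\<close>
  lowers the first summand by \<open>5 m\<^sub>j = 25^j\<close> and raises the second by at most \<open>25^j\<close>
  (\<open>count_common_suffix_xelem\<close>), and a letter of \<open>S\<close> raises the potential by at most \<open>5\<close>.
  Therefore the value of the potential at \<open>\<gamma>\<close> is at most \<open>5 |\<gamma>|\<close>.\<close>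

section \<open>Words in the free group\<close>

interpretation free_group: group "(*) :: 'a free_group \<Rightarrow> _" 1 inverse
  by unfold_locales (simp_all add: fg_left_inverse)

lemma Rep_one: "Rep_free_group 1 = []"
  by (rule one_free_group.rep_eq)

lemma Rep_mult: "Rep_free_group (x * y) = foldr push (Rep_free_group x) (Rep_free_group y)"
  by (rule times_free_group.rep_eq)

lemma Rep_inverse: "Rep_free_group (inverse x) = rev (map linv (Rep_free_group x))"
  by (rule inverse_free_group.rep_eq)

lemma Rep_gen: "Rep_free_group (fg_gen x) = [(x, True)]"
  by (rule fg_gen.rep_eq)

lemma Rep_gen_power: "Rep_free_group (fg_gen x ^ n) = replicate n (x, True)"
  by (induction n) (auto simp: Rep_one Rep_mult Rep_gen push_def linv_def)

lemma length_push: "length (push l w) \<le> Suc (length w)"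
  by (auto simp: push_def)

lemma length_foldr_push: "length (foldr push u w) \<le> length u + length w"
  by (induction u) (auto intro: order_trans[OF length_push])

lemma length_Rep_le_word_length: "length (Rep_free_group g) \<le> word_length S3 g"
proof -
  obtain ws where ws: "set ws \<subseteq> S3" "prod_list ws = g" "length ws = word_length S3 g"
    using S3_generates[of g] word_length_wit by metis
  have "set ws \<subseteq> S3 \<Longrightarrow> length (Rep_free_group (prod_list ws)) \<le> length ws" for ws
  proof (induction ws)
    case (Cons x ws)
    then have "length (Rep_free_group x) = 1"
      by (auto simp: S3_def Rep_gen Rep_inverse)
    with Cons show ?case
      using length_foldr_push[of "Rep_free_group x" "Rep_free_group (prod_list ws)"]
      by (simp add: Rep_mult)
  qed (simp add: Rep_one)
  with ws show ?thesis by metis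
qed

section \<open>Common suffixes with a fixed word\<close>

text \<open>The longest suffix of the second word that is also a suffix of the first.  In the Cayley
  tree of the free group (letters being multiplied from the left) this is the nearest-point
  projection onto the geodesic from the identity to \<open>\<gamma>\<close>.\<close>

primrec common_suffix :: "'a list \<Rightarrow> 'a list \<Rightarrow> 'a list" where
  "common_suffix \<gamma> [] = []"
| "common_suffix \<gamma> (l # w) = (if suffix (l # w) \<gamma> then l # w else common_suffix \<gamma> w)"

lemma suffix_common_suffix: "suffix (common_suffix \<gamma> w) \<gamma>"
  by (induction w) auto

lemma suffix_common_suffix2: "suffix (common_suffix \<gamma> w) w"
  by (induction w) (auto intro: suffix_ConsI)

lemma common_suffix_eq: "suffix w \<gamma> \<Longrightarrow> common_suffix \<gamma> w = w"
  by (cases w) auto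

text \<open>A word that has left the geodesic through the letter \<open>l\<close> keeps its projection as long as it does
  not come back through that letter.\<close>

lemma common_suffix_branch:
  assumes "\<not> suffix (l # z) \<gamma>" "suffix (l # z) w"
  shows "common_suffix \<gamma> w = common_suffix \<gamma> z"
  using assms(2)
proof (induction w)
  case (Cons x w)
  then have "l # z = x # w \<or> suffix (l # z) w"
    by (auto simp: suffix_Cons)
  moreover have "\<not> suffix (x # w) \<gamma>"
    using assms(1) Cons.prems suffix_order.trans by blast
  ultimately show ?case using Cons.IH by auto
qed simp

lemma count_list_suffix_mono: "suffix u w \<Longrightarrow> count_list u y \<le> count_list w y"
  by (auto simp: suffix_def)

lemma count_common_suffix_tl: "count_list (common_suffix \<gamma> (tl w)) y \<le> count_list (common_suffix \<gamma> w) y"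
proof (cases w)
  case (Cons l w')
  show ?thesis
    using suffix_common_suffix2[of \<gamma> w'] Cons by (auto dest: count_list_suffix_mono[where y = y])
qed simp

text \<open>If the letter cancels, the projection can only shrink; otherwise it grows by that letter or stays.\<close>

lemma count_common_suffix_push:
  "count_list (common_suffix \<gamma> (push l w)) y \<le> count_list (common_suffix \<gamma> w) y + (if l = y then 1 else 0)"
  using count_common_suffix_tl[of \<gamma> w y]
  by (auto simp: push_def common_suffix_eq dest: suffix_ConsD)

lemma count_common_suffix_foldr_push:
  "count_list (common_suffix \<gamma> (foldr push u w)) y \<le> count_list (common_suffix \<gamma> w) y + count_list u y"
proof (induction u)
  case (Cons l u)
  then show ?case
    using count_common_suffix_push[of \<gamma> l "foldr push u w" y] by (auto split: if_splits)
qed simp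

lemma count_replicate: "count_list (replicate n x) y = (if x = y then n else 0)"
  by (induction n) auto

section \<open>Cancellation\<close>

text \<open>A run of equal letters advances the projection only after all letters that it cancels are used up,
  and from then on the run stays visible at the head of the word.\<close>

lemma foldr_push_run_head:
  assumes "count_list (common_suffix \<gamma> w) l < count_list (common_suffix \<gamma> (foldr push (replicate n l) w)) l"
  shows "\<exists>z. foldr push (replicate n l) w = l # z"
  using assms
proof (induction n)
  case (Suc n)
  define u where "u = foldr push (replicate n l) w"
  have step: "foldr push (replicate (Suc n) l) w = push l u" by (simp add: u_def)
  show ?case
  proof (cases "count_list (common_suffix \<gamma> w) l < count_list (common_suffix \<gamma> u) l")
    case True
    then obtain z where "u = l # z" using Suc.IH u_def by blast
    moreover have "l \<noteq> linv l" by (cases l) (simp add: linv_def)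
    ultimately show ?thesis unfolding step by (simp add: push_def)
  next
    case False
    with Suc.prems have "push l u \<noteq> tl u"
      using count_common_suffix_tl[of \<gamma> u l] unfolding step by force
    then show ?thesis unfolding step by (auto simp: push_def split: if_splits)
  qed
qed simp

lemma foldr_push_replicate_append:
  assumes "z = [] \<or> l \<noteq> linv (hd z)"
  shows "foldr push (replicate n l) z = replicate n l @ z"
proof (induction n)
  case (Suc n)
  have ne: "l \<noteq> linv l" "linv l \<noteq> l" by (cases l; simp add: linv_def)+
  have "hd z \<noteq> linv l \<or> z = []" using assms by auto
  then have "push l (replicate n l @ z) = l # replicate n l @ z"
    using ne by (cases n) (auto simp: push_def)
  with Suc show ?case by simp
qed simp

lemma suffix_replicate_append: "m \<le> n \<Longrightarrow> suffix (replicate m l @ z) (replicate n l @ z)"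
  using suffixI[of "replicate n l" "replicate (n - m) l" "replicate m l"]
  by (simp add: replicate_add[symmetric])

text \<open>One letter erodes a block of equal letters by at most one; this is how a block that is longer
  than the conjugators \<open>v\<close> survives multiplication by them.\<close>

lemma suffix_run_push:
  assumes "suffix (replicate (Suc n) l @ z) w"
  shows "suffix (replicate n l @ z) (push x w)"
proof -
  obtain p where p: "w = p @ l # replicate n l @ z"
    using assms by (auto simp: suffix_def)
  then have "suffix (replicate n l @ z) (tl w)" by (cases p) (auto simp: suffix_def)
  moreover have "suffix (replicate n l @ z) (x # w)"
    unfolding p suffix_def by (intro exI[of _ "x # p @ [l]"]) simp
  ultimately show ?thesis by (simp add: push_def)
qed

lemma suffix_run_foldr_push:
  assumes "suffix (replicate (length u + n) l @ z) w"
  shows "suffix (replicate n l @ z) (foldr push u w)"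
  using assms
proof (induction u arbitrary: n)
  case (Cons x u)
  have "suffix (replicate (Suc n) l @ z) (foldr push u w)"
    by (rule Cons.IH) (use Cons.prems in simp)
  then show ?case using suffix_run_push by simp
qed simp

text \<open>A run in another generator does not erode the block at all, whatever its length.\<close>

lemma suffix_run_foldr_push_run:
  assumes "l \<noteq> linv x" "suffix (replicate (Suc n) l @ z) w"
  shows "suffix (replicate (Suc n) l @ z) (foldr push (replicate m x) w)"
proof (induction m)
  case (Suc m)
  let ?w = "foldr push (replicate m x) w"
  obtain p where p: "?w = p @ l # replicate n l @ z"
    using Suc by (auto simp: suffix_def)
  have "suffix (l # replicate n l @ z) (push x ?w)"
  proof (cases "?w \<noteq> [] \<and> hd ?w = linv x")
    case True
    with p assms(1) have "p \<noteq> []" by auto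
    with p True show ?thesis by (simp add: push_def suffix_def)
  next
    case False
    then have "push x ?w = x # ?w" by (auto simp only: push_def if_False)
    with p show ?thesis by (simp add: suffix_def)
  qed
  then show ?case by simp
qed (use assms in simp)

section \<open>A lower bound for the length with respect to X\<close>

abbreviation A :: "gen3 \<times> bool" where "A \<equiv> (GA, True)"
abbreviation B :: "gen3 \<times> bool" where "B \<equiv> (GB, True)"
abbreviation C :: "gen3 \<times> bool" where "C \<equiv> (GC, True)"

text \<open>The condition on the target word that makes the potential work. If the projection stands at the
  end of a block of \<open>b\<close> that is followed by \<open>a\<close>, then before the next block of \<open>b\<close> it has to pass at
  least as many letters \<open>c\<close> as there are letters \<open>b\<close> behind it.\<close>

definition buffered :: "(gen3 \<times> bool) list \<Rightarrow> bool" where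
  "buffered \<gamma> \<longleftrightarrow> (\<forall>w s. suffix (A # B # w) \<gamma> \<longrightarrow> suffix s \<gamma> \<longrightarrow>
     count_list (B # w) B < count_list s B \<longrightarrow>
     count_list (B # w) C + count_list (B # w) B \<le> count_list s C)"

lemma five_power_odd: "j \<ge> 1 \<Longrightarrow> 5 * (5::'a::comm_semiring_1) ^ (2 * j - 1) = 25 ^ j"
  by (cases j) (simp_all add: power_mult)

text \<open>The main estimate. Read from the right, \<open>x(v,j)\<close> consists of \<open>b^(25^j)\<close>, \<open>a^(25^j)\<close>, \<open>v\<^sup>-\<^sup>1\<close>,
  \<open>b^m\<close> and \<open>v\<close>, where \<open>q = 5^j\<close> bounds the length of \<open>v\<close> and \<open>25^j = q\<^sup>2 = 5 m\<close>. The last three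
  pieces can gain at most \<open>2 q + m\<close> letters \<open>b\<close>, which is harmless unless the first piece has gained
  some. If it has, then \<open>a^(25^j)\<close> either leads away from the target, too far for the two
  conjugators to return, or it stays on the target. In the second case a further gain requires
  passing at least as many letters \<open>c\<close> as letters \<open>b\<close> have been covered; the conjugators provide at
  most \<open>2 q\<close> of them, so that only \<open>2 q\<close> letters \<open>b\<close> can have been covered before.\<close>

lemma count_common_suffix_xelem:
  assumes \<gamma>: "buffered \<gamma>" and v: "word_length S3 v \<le> 5 ^ j" and j: "j \<ge> 1"
  shows "count_list (common_suffix \<gamma> (Rep_free_group (xelem v j * g))) B
      \<le> count_list (common_suffix \<gamma> (Rep_free_group g)) B + 25 ^ j"
proof -
  define q :: nat where "q = 5 ^ j"
  define m :: nat where "m = 5 ^ (2 * j - 1)"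
  define V where "V = Rep_free_group v"
  define V' where "V' = Rep_free_group (inverse v)"
  define w0 where "w0 = Rep_free_group g"
  define w1 where "w1 = foldr push (replicate (25 ^ j) B) w0"
  define w2 where "w2 = foldr push (replicate (25 ^ j) A) w1"
  define w3 where "w3 = foldr push V' w2"
  define w4 where "w4 = foldr push (replicate m B) w3"
  define w5 where "w5 = foldr push V w4"
  define L where "L l w = count_list (common_suffix \<gamma> w) l" for l w
  have pw: "(5::nat) ^ (2 * j) = 25 ^ j" by (simp add: power_mult)
  have q5: "q \<ge> 5" using power_increasing[of 1 j "5::nat"] j by (simp add: q_def)
  have qq: "25 ^ j = q * q" by (simp add: q_def power_mult_distrib[symmetric])
  have mq: "5 * m = 25 ^ j" unfolding m_def using j by (rule five_power_odd)
  have big: "4 * q + m \<le> 25 ^ j"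
    using mult_le_mono1[OF q5, of q] mq qq by linarith
  have w5: "Rep_free_group (xelem v j * g) = w5"
    by (simp add: xelem_def mult.assoc Rep_mult Rep_gen_power w5_def w4_def w3_def w2_def w1_def
        w0_def V_def V'_def m_def pw)
  have lV: "length V \<le> q" "length V' \<le> q"
    using length_Rep_le_word_length[of v] v by (auto simp: V_def V'_def Rep_inverse q_def)
  have cV: "count_list V l \<le> q" "count_list V' l \<le> q" for l
    using lV count_le_length[of V] count_le_length[of V'] le_trans by blast+
  have L2: "L l w2 \<le> L l w1" if "l \<noteq> A" for l
    using count_common_suffix_foldr_push[of \<gamma> "replicate (25 ^ j) A" w1 l] that
    by (simp add: w2_def L_def count_replicate)
  have L5: "L l w5 \<le> L l w2 + 2 * q + (if l = B then m else 0)" for l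
    using count_common_suffix_foldr_push[of \<gamma> V' w2 l]
      count_common_suffix_foldr_push[of \<gamma> "replicate m B" w3 l]
      count_common_suffix_foldr_push[of \<gamma> V w4 l] cV[of l]
    by (auto simp: w3_def w4_def w5_def L_def count_replicate)
  have L1: "L B w1 \<le> L B w0 + 25 ^ j"
    using count_common_suffix_foldr_push[of \<gamma> "replicate (25 ^ j) B" w0 B]
    by (simp add: w1_def L_def count_replicate)
  have "L B w5 \<le> L B w0 + 25 ^ j"
  proof (cases "L B w0 < L B w1")
    case False
    then show ?thesis using L2[of B] L5[of B] big by simp
  next
    case True
    then obtain z where z: "w1 = B # z"
      using foldr_push_run_head[of \<gamma> w0 B "25 ^ j"] by (auto simp: L_def w1_def)
    have w2: "w2 = replicate (25 ^ j) A @ B # z"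
      unfolding w2_def z by (rule foldr_push_replicate_append) (auto simp: linv_def)
    \<comment> \<open>Is the projection about to move along \<open>a\<close>, or does the block of \<open>a\<close> leave the target?\<close>
    show ?thesis
    proof (cases "suffix (A # B # z) \<gamma>")
      case False
      \<comment> \<open>Each conjugator erodes the block of \<open>25^j\<close> letters \<open>a\<close> by at most \<open>q\<close>, and \<open>2 q < q\<^sup>2\<close>.\<close>
      define r where "r = 25 ^ j - 2 * q - 1"
      have r: "25 ^ j = q + (q + Suc r)" using big q5 by (simp add: r_def)
      have "suffix (replicate (q + Suc r) A @ B # z) (foldr push V' w2)"
        unfolding w2 using lV r by (intro suffix_run_foldr_push suffix_replicate_append) simp
      then have "suffix (replicate (q + Suc r) A @ B # z) w4"
        unfolding w4_def w3_def
        using suffix_run_foldr_push_run[of A B "q + r"] by (simp add: linv_def)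
      then have "suffix (replicate (length V + Suc r) A @ B # z) w4"
        by (rule suffix_order.trans[OF suffix_replicate_append, rotated]) (use lV in simp)
      then have "suffix (replicate (Suc r) A @ B # z) w5"
        unfolding w5_def by (rule suffix_run_foldr_push)
      then have "suffix (A # B # z) w5"
        using suffix_appendD[of "replicate r A" "A # B # z" w5]
        by (simp add: replicate_append_same[symmetric])
      then have "common_suffix \<gamma> w5 = common_suffix \<gamma> w1"
        using common_suffix_branch[OF False] z by simp
      then show ?thesis using L1 by (simp add: L_def)
    next
      case on: True
      then have cw1: "common_suffix \<gamma> w1 = B # z"
        unfolding z by (intro common_suffix_eq) (rule suffix_ConsD)
      show ?thesis
      proof (cases "L B w1 < L B w5")
        case True
        \<comment> \<open>Only the conjugators contain letters \<open>c\<close>, at most \<open>q\<close> each.\<close>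
        then have "L C w1 + L B w1 \<le> L C w5"
          using \<gamma> on suffix_common_suffix[of \<gamma> w5] unfolding buffered_def L_def cw1 by blast
        with L2[of C] L5[of C] have "L B w1 \<le> 2 * q" by simp
        with L2[of B] L5[of B] big show ?thesis by simp
      qed (use L1 in simp)
    qed
  qed
  then show ?thesis by (simp add: w5 L_def w0_def)
qed

definition height_letter :: "gen3 \<times> bool \<Rightarrow> int" where
  "height_letter l = (if snd l = (fst l \<noteq> GB) then 1 else - 1)"

definition height :: "F3 \<Rightarrow> int" where
  "height g = sum_list (map height_letter (Rep_free_group g))"

lemma height_letter_linv: "height_letter (linv l) = - height_letter l"
  by (auto simp: height_letter_def linv_def)

lemma height_mult: "height (x * y) = height x + height y"
proof -
  have push: "sum_list (map height_letter (push l w)) = height_letter l + sum_list (map height_letter w)"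
    for l w
    by (cases w) (auto simp: push_def height_letter_linv)
  have "sum_list (map height_letter (foldr push u w))
      = sum_list (map height_letter u) + sum_list (map height_letter w)" for u w
    by (induction u) (auto simp: push)
  then show ?thesis by (simp add: height_def Rep_mult)
qed

lemma height_one: "height 1 = 0"
  by (simp add: height_def Rep_one)

lemma height_inverse: "height (inverse x) = - height x"
  using height_mult[of x "inverse x"] by (simp add: fg_right_inverse height_one)

lemma height_gen_power: "height (fg_gen x ^ n) = (if x = GB then - int n else int n)"
  by (simp add: height_def Rep_gen_power sum_list_replicate height_letter_def)

text \<open>The homomorphism \<open>height\<close> alone vanishes at every \<open>a^K b^K\<close>. The second summand lowers the
  loss per letter \<open>b\<close> from \<open>5\<close> to \<open>4\<close>, but only along the geodesic to \<open>\<gamma>\<close>.\<close>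

definition potential :: "(gen3 \<times> bool) list \<Rightarrow> F3 \<Rightarrow> int" where
  "potential \<gamma> g = 5 * height g + int (count_list (common_suffix \<gamma> (Rep_free_group g)) B)"

text \<open>The worst cases are \<open>a\<close>, \<open>c\<close> and \<open>b\<^sup>-\<^sup>1\<close>, which raise the height without advancing the count;
  the letter \<open>b\<close> lowers the potential by at least \<open>4\<close>.\<close>

lemma potential_S3:
  assumes "x \<in> S3"
  shows "potential \<gamma> (x * g) \<le> potential \<gamma> g + 5"
proof -
  have "length (Rep_free_group x) = 1"
    using assms by (auto simp: S3_def Rep_gen Rep_inverse)
  then obtain l where l: "Rep_free_group x = [l]"
    by (auto simp: length_Suc_conv)
  have "height x = height_letter l" by (simp add: height_def l)
  moreover have "5 * height_letter l + (if l = B then 1 else 0) \<le> 5"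
    by (auto simp: height_letter_def)
  ultimately show ?thesis
    using count_common_suffix_push[of \<gamma> l "Rep_free_group g" B]
    by (auto simp: potential_def height_mult Rep_mult l split: if_splits)
qed

lemma potential_xelem:
  assumes "buffered \<gamma>" "word_length S3 v \<le> 5 ^ j" "j \<ge> 1"
  shows "potential \<gamma> (xelem v j * g) \<le> potential \<gamma> g"
proof -
  have "5 * height (xelem v j) = - int (25 ^ j)"
    using five_power_odd[OF assms(3), where ?'a = int]
    by (simp add: xelem_def height_mult height_inverse height_gen_power)
  then show ?thesis
    using of_nat_mono[OF count_common_suffix_xelem[OF assms, of g], where ?'a = int]
    by (simp add: potential_def height_mult)
qed

lemma potential_le_word_length:
  assumes "buffered \<gamma>"
  shows "potential \<gamma> g \<le> 5 * int (word_length X3 g)"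
proof -
  obtain ws where ws: "set ws \<subseteq> X3" "prod_list ws = g" "length ws = word_length X3 g"
    using X3_generates[of g] word_length_wit by metis
  have "set ws \<subseteq> X3 \<Longrightarrow> potential \<gamma> (prod_list ws) \<le> 5 * int (length ws)" for ws
  proof (induction ws)
    case (Cons x ws)
    then consider "x \<in> S3" | v j where "x = xelem v j" "word_length S3 v \<le> 5 ^ j" "j \<ge> 1"
      by (auto simp: X3_def Xj_def)
    then have "potential \<gamma> (x * prod_list ws) \<le> potential \<gamma> (prod_list ws) + 5"
    proof cases
      case 1
      then show ?thesis by (rule potential_S3)
    next
      case (2 v j)
      then show ?thesis
        using potential_xelem[OF assms, of v j "prod_list ws"] by simp
    qed
    with Cons show ?case by simp
  qed (simp add: potential_def height_one Rep_one)
  with ws show ?thesis by metis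
qed

text \<open>The second assumption and the second conclusion, which compare with the whole word instead of a suffix,
  are what the induction over towers carries along: a position in the old word has to be compared
  with suffixes that reach into the new blocks.\<close>

lemma buffered_extend:
  assumes w: "buffered w" "\<And>u. suffix (A # B # u) w \<Longrightarrow>
      count_list (B # u) C + count_list (B # u) B \<le> count_list w C"
    and N: "K + count_list w B \<le> N" and K: "K > 0"
  defines "\<gamma> \<equiv> replicate N C @ replicate K A @ replicate K B @ w"
  shows "buffered \<gamma>"
    and "suffix (A # B # u) \<gamma> \<Longrightarrow> count_list (B # u) C + count_list (B # u) B \<le> count_list \<gamma> C"
proof -
  \<comment> \<open>The pattern \<open>a b\<close> occurs only once in the new blocks.\<close>
  have suf: "suffix (A # B # u) w \<or> B # u = replicate K B @ w" if u: "suffix (A # B # u) \<gamma>" for u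
  proof -
    have "suffix (A # B # u) ((replicate N C @ replicate K A) @ (replicate K B @ w))"
      using u by (simp add: \<gamma>_def)
    then consider "suffix (A # B # u) (replicate K B @ w)"
      | x where "A # B # u = x @ (replicate K B @ w)" "suffix x (replicate N C @ replicate K A)"
      unfolding suffix_append by blast
    then show ?thesis
    proof cases
      case 1
      then consider "suffix (A # B # u) w" | x where "A # B # u = x @ w" "suffix x (replicate K B)"
        unfolding suffix_append by blast
      then show ?thesis
      proof cases
        case (2 x)
        then have "set x \<subseteq> {B}" using set_mono_suffix[of x "replicate K B"] by auto
        with 2 have "x = []" by (cases x) auto
        with 2 show ?thesis by simp
      qed simp
    next
      case (2 x)
      then have "set x \<subseteq> {A, C}" using set_mono_suffix[OF 2(2)] by auto
      with 2 K show ?thesis by (cases x; cases "tl x"; cases K) auto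
    qed
  qed
  have \<gamma>C: "count_list \<gamma> C = N + count_list w C" and \<gamma>B: "count_list \<gamma> B = K + count_list w B"
    by (simp_all add: \<gamma>_def count_replicate)
  show top: "count_list (B # u) C + count_list (B # u) B \<le> count_list \<gamma> C"
    if "suffix (A # B # u) \<gamma>" for u
    using suf[OF that]
  proof
    assume "suffix (A # B # u) w"
    then show ?thesis using w(2)[of u] \<gamma>C by simp
  next
    \<comment> \<open>At the new block of \<open>b\<close> the \<open>N\<close> new letters \<open>c\<close> outnumber all letters \<open>b\<close>.\<close>
    assume u: "B # u = replicate K B @ w"
    show ?thesis unfolding u using N \<gamma>C by (simp add: count_replicate)
  qed
  have ws: "suffix w \<gamma>" by (simp add: \<gamma>_def suffix_appendI)
  show "buffered \<gamma>"
    unfolding buffered_def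
  proof (intro allI impI)
    fix u s assume u: "suffix (A # B # u) \<gamma>" and s: "suffix s \<gamma>"
      and less: "count_list (B # u) B < count_list s B"
    show "count_list (B # u) C + count_list (B # u) B \<le> count_list s C"
      using suf[OF u]
    proof
      assume uw: "suffix (A # B # u) w"
      show ?thesis
      proof (cases "suffix s w")
        case True
        then show ?thesis using w(1) uw less unfolding buffered_def by blast
      next
        case False
        then have "suffix w s" using suffix_same_cases[OF s ws] by blast
        then show ?thesis using w(2)[OF uw] count_list_suffix_mono[of w s C] by simp
      qed
    next
      assume "B # u = replicate K B @ w"
      then have "count_list (B # u) B = count_list \<gamma> B" unfolding \<gamma>B by (simp add: count_replicate)
      with less count_list_suffix_mono[OF s, of B] show ?thesis by simp
    qed
  qed
qed

text \<open>The products \<open>c^N\<^sub>1 p\<^sub>k\<^sub>1 c^N\<^sub>2 p\<^sub>k\<^sub>2 \<dots>\<close> in which each power of \<open>c\<close> is at least as long as the number of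
  letters \<open>b\<close> to its right, together with the sum of all \<open>N\<^sub>i + m\<close>, where \<open>m = 5^(2 k - 1)\<close>.\<close>

inductive tower :: "F3 \<Rightarrow> nat \<Rightarrow> bool" where
  tower_one: "tower 1 0"
| tower_mult: "tower g s \<Longrightarrow> k \<ge> 1 \<Longrightarrow> 25 ^ k + count_list (Rep_free_group g) B \<le> N \<Longrightarrow>
    tower (gc ^ N * (ga ^ (5 ^ (2 * k)) * gb ^ (5 ^ (2 * k))) * g) (N + 5 ^ (2 * k - 1) + s)"

lemma Rep_tower_mult:
  assumes "Rep_free_group g = [] \<or> hd (Rep_free_group g) = C" "K > 0"
  shows "Rep_free_group (gc ^ N * (ga ^ K * gb ^ K) * g)
      = replicate N C @ replicate K A @ replicate K B @ Rep_free_group g"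
  unfolding mult.assoc Rep_mult Rep_gen_power
  using assms by (subst foldr_push_replicate_append, force simp: linv_def)+ simp

lemma
  assumes "tower g s"
  shows buffered_tower: "buffered (Rep_free_group g)"
    and height_tower: "5 * height g + int (count_list (Rep_free_group g) B) = 5 * int s"
proof -
  have "(Rep_free_group g = [] \<or> hd (Rep_free_group g) = C) \<and> buffered (Rep_free_group g) \<and>
      (\<forall>u. suffix (A # B # u) (Rep_free_group g) \<longrightarrow>
         count_list (B # u) C + count_list (B # u) B \<le> count_list (Rep_free_group g) C) \<and>
      5 * height g + int (count_list (Rep_free_group g) B) = 5 * int s"
    using assms
  proof induction
    case tower_one
    then show ?case by (simp add: Rep_one height_one buffered_def)
  next
    case (tower_mult g s k N)
    let ?K = "25 ^ k :: nat"
    have pw: "(5::nat) ^ (2 * k) = ?K" by (simp add: power_mult)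
    define g' where "g' = gc ^ N * (ga ^ ?K * gb ^ ?K) * g"
    have rep: "Rep_free_group g' = replicate N C @ replicate ?K A @ replicate ?K B @ Rep_free_group g"
      unfolding g'_def by (rule Rep_tower_mult) (use tower_mult in auto)
    have "N > 0" using tower_mult.hyps(3) by (metis add_is_0 gr0I le_zero_eq power_not_zero zero_neq_numeral)
    then have hd: "hd (Rep_free_group g') = C" by (cases N) (auto simp: rep)
    have "height g' = int N + height g"
      by (simp add: g'_def height_mult height_gen_power)
    moreover have "count_list (Rep_free_group g') B = ?K + count_list (Rep_free_group g) B"
      by (simp add: rep count_replicate)
    moreover have "5 * 5 ^ (2 * k - 1) = (25 ^ k :: int)"
      using tower_mult.hyps(2) by (rule five_power_odd)
    ultimately have "5 * height g' + int (count_list (Rep_free_group g') B)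
        = 5 * int (N + 5 ^ (2 * k - 1) + s)"
      using tower_mult.IH by (simp add: algebra_simps)
    moreover have "buffered (Rep_free_group g')"
      unfolding rep by (rule buffered_extend) (use tower_mult in auto)
    moreover have "count_list (B # u) C + count_list (B # u) B \<le> count_list (Rep_free_group g') C"
      if "suffix (A # B # u) (Rep_free_group g')" for u
      by (insert that, unfold rep, rule buffered_extend(2)) (use tower_mult in auto)
    ultimately show ?case
      unfolding pw g'_def[symmetric] using hd by blast
  qed
  then show "buffered (Rep_free_group g)"
    "5 * height g + int (count_list (Rep_free_group g) B) = 5 * int s" by blast+
qed

text \<open>At its own target the projection has covered everything, and the potential is \<open>5 s\<close>.\<close>

lemma tower_le_word_length:
  assumes "tower g s"
  shows "s \<le> word_length X3 g"
  using potential_le_word_length[OF buffered_tower[OF assms], of g] height_tower[OF assms]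
  by (simp add: potential_def common_suffix_eq)

section \<open>The lengths of products of powers of a and b\<close>

lemma word_length_power: "x \<in> T \<Longrightarrow> word_length T (x ^ n) \<le> n"
proof -
  have "prod_list (replicate n x) = x ^ n" by (induction n) auto
  then show "x \<in> T \<Longrightarrow> word_length T (x ^ n) \<le> n"
    using word_length_le[of "replicate n x" T] by (auto simp: subset_iff)
qed

lemma gen_in_X3: "ga \<in> X3" "gb \<in> X3" "gc \<in> X3" "inverse gb \<in> X3"
  by (simp_all add: X3_def S3_def)

abbreviation pk :: "nat \<Rightarrow> F3" where
  "pk k \<equiv> ga ^ (5 ^ (2 * k)) * gb ^ (5 ^ (2 * k))"

lemma inverse_power_gb: "inverse gb ^ n * gb ^ n = 1" "gb ^ n * inverse gb ^ n = 1"
  by (simp_all only: left_right_inverse_power fg_left_inverse fg_right_inverse)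

text \<open>The factor \<open>b^m\<close> inside \<open>x(v, l)\<close> is conjugated by an arbitrary \<open>v\<close>; the choice \<open>v = t\<^sup>-\<^sup>1\<close> puts the
  compensating \<open>b^(-m)\<close> to the left of \<open>t\<close>.\<close>

lemma mult_pk_eq:
  "t * pk l = inverse gb ^ (5 ^ (2 * l - 1)) * t * xelem (inverse t) l"
proof -
  have "inverse gb ^ n * t * (inverse t * gb ^ n * inverse (inverse t) * r) = t * r" for n and r :: F3
    by (metis (no_types) fg_right_inverse free_group.inverse_inverse inverse_power_gb(1) mult.assoc mult_1_left)
  from this[of "5 ^ (2 * l - 1)" "pk l"] show ?thesis
    unfolding xelem_def by (simp only: mult.assoc)
qed

lemma xelem_in_X3: "word_length S3 v \<le> 5 ^ l \<Longrightarrow> l \<ge> 2 \<Longrightarrow> xelem v l \<in> X3"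
  by (auto simp: X3_def Xj_def)

lemma word_length_single: "x \<in> T \<Longrightarrow> word_length T x \<le> 1"
  using word_length_power[of x T 1] by simp

lemma word_length_pk_le:
  assumes "k \<ge> 2"
  shows "word_length X3 (pk k) \<le> 5 ^ (2 * k - 1) + 1"
proof -
  have "pk k = inverse gb ^ (5 ^ (2 * k - 1)) * xelem (inverse 1) k"
    using mult_pk_eq[of 1 k] by simp
  also have "word_length X3 \<dots> \<le> 5 ^ (2 * k - 1) + 1"
    using word_length_mult word_length_power[OF gen_in_X3(4)]
      word_length_single[OF xelem_in_X3[of "inverse 1" k]] assms
    by (metis (no_types) add_mono le_trans free_group.inverse_neutral word_length_one zero_le)
  finally show ?thesis .
qed

text \<open>The tower \<open>c^N p\<^sub>k\<close> has length at least \<open>N + m\<close>, and its factor \<open>c^N\<close> accounts for at most \<open>N\<close>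
  of it.\<close>

lemma word_length_pk_ge:
  assumes "k \<ge> 1"
  shows "5 ^ (2 * k - 1) \<le> word_length X3 (pk k)"
proof -
  have "tower (gc ^ (25 ^ k) * pk k * 1) (25 ^ k + 5 ^ (2 * k - 1) + 0)"
    by (rule tower_mult[OF tower_one assms]) (simp add: Rep_one)
  from tower_le_word_length[OF this]
  have "25 ^ k + 5 ^ (2 * k - 1) \<le> word_length X3 (gc ^ (25 ^ k) * pk k)" by simp
  also have "\<dots> \<le> 25 ^ k + word_length X3 (pk k)"
    using word_length_mult[of "gc ^ (25 ^ k)" "pk k"] word_length_power[OF gen_in_X3(3), of "25 ^ k"]
    by linarith
  finally show ?thesis by simp
qed

text \<open>Since \<open>k < l\<close>, the block \<open>b^K\<close> of the left factor is absorbed by the \<open>b^(-m)\<close> that arrives from the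
  right. The remaining \<open>a^K b^(K - m)\<close> costs \<open>m\<close>, no more than \<open>b^(-m)\<close> alone: the left factor has
  become free of charge.\<close>

lemma word_length_pk_mult_pk_le:
  assumes "k < l" "l \<ge> 2" "word_length S3 (inverse t) \<le> 5 ^ l"
  shows "word_length X3 (pk k * t * pk l) \<le> word_length X3 t + 5 ^ (2 * l - 1) + 1"
proof -
  define K :: nat where "K = 5 ^ (2 * k)"
  define m :: nat where "m = 5 ^ (2 * l - 1)"
  have "K \<le> m" unfolding K_def m_def by (rule power_increasing) (use assms in auto)
  have "pk k * inverse gb ^ m = ga ^ K * (gb ^ K * inverse gb ^ K) * inverse gb ^ (m - K)"
    unfolding K_def[symmetric] using \<open>K \<le> m\<close>
    by (metis (no_types) le_add_diff_inverse mult.assoc power_add)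
  also have "gb ^ K * inverse gb ^ K = 1"
    by (rule inverse_power_gb)
  finally have cancel: "pk k * inverse gb ^ m = ga ^ K * inverse gb ^ (m - K)" by simp
  have "pk k * t * pk l = pk k * inverse gb ^ m * t * xelem (inverse t) l"
    using arg_cong[OF mult_pk_eq[of t l], of "(*) (pk k)"] unfolding m_def by (simp only: mult.assoc)
  also have "\<dots> = ga ^ K * inverse gb ^ (m - K) * t * xelem (inverse t) l"
    unfolding cancel ..
  also have "word_length X3 \<dots> \<le> (K + (m - K)) + word_length X3 t + 1"
    using word_length_power[OF gen_in_X3(1), of K] word_length_power[OF gen_in_X3(4), of "m - K"]
      word_length_single[OF xelem_in_X3[OF assms(3,2)]]
      word_length_mult[of "ga ^ K" "inverse gb ^ (m - K)"]
      word_length_mult[of "ga ^ K * inverse gb ^ (m - K)" t]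
      word_length_mult[of "ga ^ K * inverse gb ^ (m - K) * t" "xelem (inverse t) l"]
    by linarith
  finally show ?thesis using \<open>K \<le> m\<close> by (simp add: m_def)
qed

section \<open>The point masses\<close>

lemma infsum_eq_single:
  assumes "\<And>t. t \<noteq> u \<Longrightarrow> f t = 0"
  shows "infsum f UNIV = f u"
  using infsum_cong_neutral[of "{u}" UNIV f f] assms by simp

lemma norm_pmass: "norm (pmass u) = \<omega> u"
  by (simp add: norm_beurling.rep_eq bcoeff_pmass infsum_eq_single[where u = u])

lemma bcoeff_pmass_mult: "bcoeff (pmass s * x) t = bcoeff x (inverse s * t)"
  by (simp add: times_beurling.rep_eq conv_def bcoeff_pmass infsum_eq_single[where u = s])

lemma inverse_mult_eq_iff: "inverse s * t = r \<longleftrightarrow> t = s * (r :: 'a free_group)"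
  by (auto simp: mult.assoc[symmetric] fg_left_inverse fg_right_inverse)

lemma pmass_mult: "pmass s * pmass t = pmass (s * t)"
proof (rule bcoeff_inject[THEN iffD1], rule ext)
  fix r
  show "bcoeff (pmass s * pmass t) r = bcoeff (pmass (s * t)) r"
    by (simp add: bcoeff_pmass_mult bcoeff_pmass inverse_mult_eq_iff)
qed

lemma pmass_one: "pmass 1 * x = x" "x * pmass 1 = x"
proof -
  show "pmass 1 * x = x"
    by (intro bcoeff_inject[THEN iffD1] ext) (simp add: bcoeff_pmass_mult)
  show "x * pmass 1 = x"
  proof (intro bcoeff_inject[THEN iffD1] ext)
    fix t
    show "bcoeff (x * pmass 1) t = bcoeff x t"
      by (simp add: times_beurling.rep_eq conv_def bcoeff_pmass inverse_mult_eq_iff fg_left_inverse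
          infsum_eq_single[where u = t])
  qed
qed

lemma capply_diff: "capply l (x - y) = capply l x - capply l y"
  using bounded_linear_capply[of l] by (rule bounded_linear.axioms(1)[THEN linear_diff])

lemma capply_sum: "capply l (\<Sum>i\<in>F. x i) = (\<Sum>i\<in>F. capply l (x i))"
  using bounded_linear_capply[of l] by (rule bounded_linear.axioms(1)[THEN linear_sum])

lemma bcoeff_sum_pmass:
  "finite F \<Longrightarrow> bcoeff (\<Sum>u\<in>F. c u *\<^sub>C pmass u) t = (if t \<in> F then c t else 0)"
  by (induction F rule: finite_induct)
    (auto simp: zero_beurling.rep_eq plus_beurling.rep_eq scaleC_beurling.rep_eq bcoeff_pmass)

text \<open>The finitely supported elements are dense, so that the dual norm is the supremum of
  \<open>|l(\<delta>\<^sub>t)| / \<omega>(t)\<close>.\<close>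

lemma norm_cdual_le_pmass:
  assumes "0 \<le> c" and c: "\<And>t. norm (capply l (pmass t)) \<le> c * \<omega> t"
  shows "norm l \<le> c"
proof (rule norm_cdual_bound)
  fix x
  let ?w = "\<lambda>t. norm (bcoeff x t) * \<omega> t"
  have sm: "?w summable_on A" for A
    using bcoeff[of x] summable_on_subset_banach[of ?w UNIV A] by simp
  have nx: "norm x = infsum ?w UNIV" by (simp add: norm_beurling.rep_eq)
  have "norm (capply l x) \<le> c * norm x + norm l * e" if "e > 0" for e
  proof -
    obtain F where F: "finite F" "dist (sum ?w F) (norm x) \<le> e"
      using infsum_finite_approximation[OF sm[of UNIV] \<open>e > 0\<close>] nx by auto
    define y where "y = (\<Sum>u\<in>F. bcoeff x u *\<^sub>C pmass u)"
    have "norm (x - y) = infsum ?w (UNIV - F)"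
      unfolding norm_beurling.rep_eq
      by (rule infsum_cong_neutral) (use F in \<open>auto simp: minus_beurling.rep_eq y_def bcoeff_sum_pmass\<close>)
    also have "\<dots> = norm x - sum ?w F"
      using infsum_Un_disjoint[OF sm[of "UNIV - F"] sm[of F]] F nx
      by (simp add: Diff_disjoint inf_commute)
    finally have d: "norm (x - y) \<le> e" using F(2) by (simp add: dist_real_def)
    have "norm (capply l y) \<le> (\<Sum>u\<in>F. norm (bcoeff x u) * (c * \<omega> u))"
      unfolding y_def capply_sum capply_scaleC
      by (rule sum_norm_le) (auto simp: norm_mult intro!: mult_left_mono c)
    also have "\<dots> = c * sum ?w F" by (simp add: sum_distrib_left algebra_simps)
    also have "\<dots> \<le> c * norm x"
      unfolding nx using F \<open>0 \<le> c\<close> sm[of UNIV] by (intro mult_left_mono finite_sum_le_infsum) auto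
    finally have "norm (capply l y) \<le> c * norm x" .
    moreover have "norm (capply l (x - y)) \<le> norm l * e"
      using norm_capply[of l "x - y"] mult_left_mono[OF d norm_ge_zero[of l]] by linarith
    moreover have "capply l x = capply l y + capply l (x - y)" by (simp add: capply_diff)
    ultimately show ?thesis by (metis add_mono norm_triangle_le)
  qed
  then have le: "norm (capply l x) \<le> c * norm x + norm l * inverse (Suc n)" for n
    by simp
  have "(\<lambda>n. c * norm x + norm l * inverse (Suc n)) \<longlonglongrightarrow> c * norm x + norm l * 0"
    by (intro tendsto_intros LIMSEQ_inverse_real_of_nat)
  then show "norm (capply l x) \<le> c * norm x"
    using LIMSEQ_le_const[of _ _ "norm (capply l x)"] le by simp
qed (rule assms)

definition normalized_pmass :: "F3 \<Rightarrow> beurling" where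
  "normalized_pmass u = complex_of_real (1 / \<omega> u) *\<^sub>C pmass u"

lemma norm_normalized_pmass: "norm (normalized_pmass u) = 1"
  using \<omega>_pos(1)[of u, THEN less_imp_neq] by (simp add: normalized_pmass_def norm_scaleC norm_pmass norm_divide)

lemma gseq_eq: "gseq k = normalized_pmass (pk k)"
  by (simp add: gseq_def normalized_pmass_def Let_def)

text \<open>The weight itself as an element of the dual; it detects the norm of every point mass.\<close>

definition weight_functional :: "beurling cdual" where
  "weight_functional = CDual (\<lambda>x. \<Sum>\<^sub>\<infinity>t. bcoeff x t * of_real (\<omega> t))"

lemma weight_functional_apply:
    "capply weight_functional x = (\<Sum>\<^sub>\<infinity>t. bcoeff x t * of_real (\<omega> t))"
  and norm_weight_functional: "norm weight_functional \<le> 1"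
proof -
  let ?f = "\<lambda>x t. bcoeff x t * complex_of_real (\<omega> t)"
  have abs: "(\<lambda>t. norm (?f x t)) summable_on UNIV" for x
    using bcoeff[of x] by (simp add: norm_mult)
  have b: "norm (infsum (?f x) UNIV) \<le> 1 * norm x" for x
    using norm_infsum_bound[OF abs[of x]] by (simp add: norm_mult norm_beurling.rep_eq)
  have "bounded_clinear (\<lambda>x. infsum (?f x) UNIV)"
  proof (rule bounded_clinearI)
    show "infsum (?f (x + y)) UNIV = infsum (?f x) UNIV + infsum (?f y) UNIV" for x y
      using infsum_add[OF abs_summable_summable[OF abs[of x]] abs_summable_summable[OF abs[of y]]]
      by (simp add: plus_beurling.rep_eq distrib_right)
    show "infsum (?f (c *\<^sub>C x)) UNIV = c * infsum (?f x) UNIV" for c x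
      by (simp add: scaleC_beurling.rep_eq mult.assoc infsum_cmult_right')
  qed (rule b)
  then show *: "capply weight_functional x = infsum (?f x) UNIV" for x
    unfolding weight_functional_def by (simp add: capply_CDual)
  show "norm weight_functional \<le> 1"
    by (rule norm_cdual_bound) (use b in \<open>auto simp: *\<close>)
qed

lemma weight_functional_pmass: "capply weight_functional (pmass t) = of_real (\<omega> t)"
  by (simp add: weight_functional_apply bcoeff_pmass infsum_eq_single[where u = t])

section \<open>Weak* limits\<close>

lemma norm_weak_star_lim_le:
  assumes "weak_star_lim f \<Phi> F" "F \<noteq> bot" "\<forall>\<^sub>F i in F. norm (capply (f i) l) \<le> c"
  shows "norm (capply \<Phi> l) \<le> c"
  using assms unfolding weak_star_lim_def by (metis Lim_norm_ubound)

lemma Re_weak_star_lim_ge: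
  assumes "weak_star_lim f \<Phi> F" "F \<noteq> bot" "\<forall>\<^sub>F i in F. c \<le> Re (capply (f i) l)"
  shows "c \<le> Re (capply \<Phi> l)"
  using assms unfolding weak_star_lim_def by (metis tendsto_Re tendsto_lowerbound)

text \<open>Alaoglu's theorem for sequences, by Tychonoff's theorem for the product of the discs that contain
  the values at the single points. The limit is taken along a filter \<open>F\<close> finer than the filter of
  cofinite sets, which replaces a subnet.\<close>

lemma weak_star_cluster_point:
  fixes f :: "nat \<Rightarrow> 'a::complex_normed_vector cdual"
  assumes c: "\<And>n. norm (f n) \<le> c"
  obtains \<Psi> F where "F \<le> sequentially" "F \<noteq> bot" "weak_star_lim f \<Psi> F"
proof -
  define K where "K = Pi\<^sub>E UNIV (\<lambda>x::'a. cball (0::complex) (c * norm x))"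
  define g where "g n = capply (f n)" for n
  have "compactin (product_topology (\<lambda>_::'a. euclidean) UNIV) K"
    unfolding K_def by (subst compactin_PiE) simp
  then have K: "compact K" by (simp add: euclidean_product_topology)
  have "g n \<in> K" for n
    using norm_capply[of "f n"] mult_right_mono[OF c[of n] norm_ge_zero]
    by (force simp: K_def g_def PiE_def intro: order_trans)
  then have "\<forall>\<^sub>F x in filtermap g sequentially. x \<in> K"
    by (simp add: eventually_filtermap)
  moreover have "filtermap g sequentially \<noteq> bot"
    by (simp add: filtermap_bot_iff)
  ultimately obtain x where x: "inf (nhds x) (filtermap g sequentially) \<noteq> bot"
    using K unfolding compact_filter by metis
  define F where "F = inf sequentially (filtercomap g (nhds x))"
  have "F \<noteq> bot"
  proof
    assume "F = bot"
    then obtain P Q where PQ: "eventually P sequentially" "eventually Q (filtercomap g (nhds x))"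
      "\<forall>n. P n \<and> Q n \<longrightarrow> False"
      unfolding F_def trivial_limit_def eventually_inf by blast
    then obtain R where R: "eventually R (nhds x)" "\<forall>n. R (g n) \<longrightarrow> Q n"
      unfolding eventually_filtercomap by blast
    have "eventually (\<lambda>y. \<not> R y) (filtermap g sequentially)"
      unfolding eventually_filtermap using PQ(1) by eventually_elim (use PQ R in blast)
    with R(1) have "eventually (\<lambda>_. False) (inf (nhds x) (filtermap g sequentially))"
      unfolding eventually_inf by blast
    with x show False by (simp add: trivial_limit_def)
  qed
  have gx: "filterlim g (nhds x) F"
    unfolding F_def filterlim_iff_le_filtercomap by simp
  then have "((\<lambda>n. g n l) \<longlongrightarrow> x l) F" for l
    using continuous_on_tendsto_compose[OF continuous_on_product_coordinates[of l] gx] by simp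
  then have lim: "((\<lambda>n. capply (f n) l) \<longlongrightarrow> x l) F" for l by (simp add: g_def)
  have "bounded_clinear x"
  proof (rule bounded_clinearI)
    show "x (u + v) = x u + x v" for u v
      using tendsto_unique[OF \<open>F \<noteq> bot\<close> lim[of "u + v"]] tendsto_add[OF lim[of u] lim[of v]]
      by (simp add: capply_add)
    show "x (a *\<^sub>C u) = a * x u" for a u
      using tendsto_unique[OF \<open>F \<noteq> bot\<close> lim[of "a *\<^sub>C u"]] tendsto_mult_left[OF lim[of u], of a]
      by (simp add: capply_scaleC)
    show "norm (x u) \<le> c * norm u" for u
      using norm_capply[of "f _" u] mult_right_mono[OF c norm_ge_zero[of u]]
      by (intro Lim_norm_ubound[OF \<open>F \<noteq> bot\<close> lim] always_eventually) (blast intro: order_trans)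
  qed
  then have "weak_star_lim f (CDual x) F"
    using lim by (simp add: weak_star_lim_def capply_CDual)
  moreover have "F \<le> sequentially" by (simp add: F_def)
  ultimately show thesis using that \<open>F \<noteq> bot\<close> by blast
qed

lemma net_filter_neq_bot:
  assumes "directed_set D le"
  shows "net_filter D le \<noteq> bot"
proof -
  have "\<not> eventually (\<lambda>_. False) (net_filter D le)"
    unfolding eventually_net_filter[OF assms] using assms unfolding directed_set_def by blast
  then show ?thesis by (simp add: trivial_limit_def)
qed

lemma subnet_map_filterlim:
  assumes "subnet_map D le {1..} (\<le>) h"
  shows "filterlim h sequentially (net_filter D le)"
  unfolding filterlim_at_top
proof
  fix n :: nat
  have D: "directed_set D le"
    and mono: "\<And>x y. x \<in> D \<Longrightarrow> y \<in> D \<Longrightarrow> le x y \<Longrightarrow> h x \<le> h y"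
    and cof: "\<And>l. l \<ge> 1 \<Longrightarrow> \<exists>x\<in>D. l \<le> h x"
    using assms unfolding subnet_map_def by auto
  obtain x where "x \<in> D" "max 1 n \<le> h x" using cof[of "max 1 n"] by auto
  then show "\<forall>\<^sub>F i in net_filter D le. n \<le> h i"
    unfolding eventually_net_filter[OF D] using mono by (meson le_trans max.bounded_iff)
qed

lemma eventually_filterlim_sequentially:
  assumes "filterlim h sequentially F" "\<And>k. k \<ge> N \<Longrightarrow> P k"
  shows "\<forall>\<^sub>F i in F. P (h i)"
  by (rule eventually_compose_filterlim[OF eventually_sequentiallyI assms(1)]) (rule assms(2))

section \<open>The first Arens product\<close>

lemma dual_right_mult: "dual_right (dual_right l x) y = dual_right l (x * y)"
  by (rule cdual_eqI) (simp add: dual_right_apply mult.assoc)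

lemma bidual_left_dual_right: "bidual_left \<Phi> (dual_right l x) = dual_right (bidual_left \<Phi> l) x"
  by (rule cdual_eqI) (simp add: bidual_left_apply dual_right_apply dual_right_mult)

lemma arens_box_assoc: "\<Theta> \<box> \<Psi> \<box> \<Phi> = \<Theta> \<box> (\<Psi> \<box> \<Phi>)"
proof -
  have "bidual_left (\<Psi> \<box> \<Phi>) l = bidual_left \<Psi> (bidual_left \<Phi> l)" for l
    by (rule cdual_eqI) (simp add: bidual_left_apply arens_box_apply bidual_left_dual_right)
  then show ?thesis by (intro cdual_eqI) (simp add: arens_box_apply)
qed

lemma bidual_embed_one_box: "bidual_embed (pmass 1) \<box> \<Phi> = \<Phi>"
proof (rule cdual_eqI)
  fix l
  have "dual_right l (pmass 1) = l" by (rule cdual_eqI) (simp add: dual_right_apply pmass_one)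
  then show "capply (bidual_embed (pmass 1) \<box> \<Phi>) l = capply \<Phi> l"
    by (simp add: arens_box_apply bidual_embed_apply bidual_left_apply)
qed

lemma capply_zero: "capply f 0 = 0" "capply 0 x = 0"
  using capply_scaleC[of f 0 0] capply_scaleC_left[of 0 0 x]
  by (simp_all add: zero_cdual.rep_eq capply_add[of f 0 0, simplified])

lemma arens_box_linear:
  "(\<Psi> + \<Psi>') \<box> \<Phi> = \<Psi> \<box> \<Phi> + \<Psi>' \<box> \<Phi>" "(c *\<^sub>C \<Psi>) \<box> \<Phi> = c *\<^sub>C (\<Psi> \<box> \<Phi>)"
  "0 \<box> \<Phi> = 0" "\<Psi> \<box> 0 = 0"
proof -
  have "bidual_left 0 l = 0" for l :: "'a cdual"
    by (rule cdual_eqI) (simp add: bidual_left_apply capply_zero)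
  then show "\<Psi> \<box> 0 = 0"
    by (intro cdual_eqI) (simp add: arens_box_apply capply_zero)
qed (auto intro!: cdual_eqI simp: arens_box_apply capply_add_left capply_scaleC_left capply_zero)

text \<open>The inner limit: for fixed \<open>k\<close> and \<open>t\<close> the elements \<open>p\<^sub>k t p\<^sub>i\<close> are eventually shorter, by at least
  \<open>m\<^sub>k - 1\<close>, than the sum of the lengths of their factors, and this gain is uniform in \<open>t\<close>.\<close>

lemma norm_inner_limit_le:
  assumes \<Phi>: "weak_star_lim (\<lambda>i. bidual_embed (gseq (h i))) \<Phi> F"
    and F: "F \<noteq> bot" "filterlim h sequentially F" and k: "k \<ge> 1"
  shows "norm (bidual_left \<Phi> (dual_right l (gseq k))) \<le> norm l * exp (1 - 5 ^ (2 * k - 1))"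
proof (rule norm_cdual_le_pmass)
  fix t
  let ?l = "dual_right (dual_right l (gseq k)) (pmass t)"
  define N where "N = max 2 (max (Suc k) (word_length S3 (inverse t)))"
  have "norm (capply (bidual_embed (gseq i)) ?l) \<le> norm l * exp (1 - 5 ^ (2 * k - 1)) * \<omega> t"
    if "i \<ge> N" for i
  proof -
    have i: "i \<ge> 2" "k < i" "word_length S3 (inverse t) \<le> i" using that by (auto simp: N_def)
    have "i \<le> 5 ^ i" by (rule less_imp_le) (rule power_gt_expt, simp)
    with i have wl: "word_length X3 (pk k * t * pk i) \<le> word_length X3 t + 5 ^ (2 * i - 1) + 1"
      by (intro word_length_pk_mult_pk_le) linarith+
    have "\<omega> (pk k * t * pk i) \<le> exp (word_length X3 t + 5 ^ (2 * i - 1) + 1)"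
      using of_nat_mono[OF wl, where ?'a = real] by (simp add: \<omega>_def)
    moreover have "exp (5 ^ (2 * k - 1)) \<le> \<omega> (pk k)" "exp (5 ^ (2 * i - 1)) \<le> \<omega> (pk i)"
      using of_nat_mono[OF word_length_pk_ge[of k], where ?'a = real]
        of_nat_mono[OF word_length_pk_ge[of i], where ?'a = real] k i by (simp_all add: \<omega>_def)
    ultimately have "\<omega> (pk k * t * pk i) / (\<omega> (pk k) * \<omega> (pk i))
        \<le> exp (word_length X3 t + 5 ^ (2 * i - 1) + 1) / (exp (5 ^ (2 * k - 1)) * exp (5 ^ (2 * i - 1)))"
      by (intro frac_le mult_mono) auto
    also have "\<dots> = exp (1 - 5 ^ (2 * k - 1)) * \<omega> t"
      by (simp add: \<omega>_def exp_add exp_diff field_simps)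
    finally have r: "\<omega> (pk k * t * pk i) / (\<omega> (pk k) * \<omega> (pk i)) \<le> exp (1 - 5 ^ (2 * k - 1)) * \<omega> t" .
    have "gseq k * (pmass t * gseq i)
        = complex_of_real (1 / (\<omega> (pk k) * \<omega> (pk i))) *\<^sub>C pmass (pk k * t * pk i)"
      by (simp add: gseq_eq normalized_pmass_def mult_scaleC_left mult_scaleC_right pmass_mult
          scaleC_scaleC mult.assoc mult.commute)
    then have "norm (capply (bidual_embed (gseq i)) ?l)
        = norm (capply l (pmass (pk k * t * pk i))) / (\<omega> (pk k) * \<omega> (pk i))"
      by (simp add: bidual_embed_apply dual_right_apply capply_scaleC norm_mult norm_divide)
    also have "\<dots> \<le> norm l * \<omega> (pk k * t * pk i) / (\<omega> (pk k) * \<omega> (pk i))"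
      using norm_capply[of l "pmass (pk k * t * pk i)"]
      by (intro divide_right_mono) (auto simp: norm_pmass)
    also have "\<dots> \<le> norm l * (exp (1 - 5 ^ (2 * k - 1)) * \<omega> t)"
      using mult_left_mono[OF r norm_ge_zero[of l]] by simp
    finally show ?thesis by (simp add: mult.assoc)
  qed
  then have "\<forall>\<^sub>F i in F. norm (capply (bidual_embed (gseq (h i))) ?l)
      \<le> norm l * exp (1 - 5 ^ (2 * k - 1)) * \<omega> t"
    by (rule eventually_filterlim_sequentially[OF F(2)])
  from norm_weak_star_lim_le[OF \<Phi> F(1) this]
  show "norm (capply (bidual_left \<Phi> (dual_right l (gseq k))) (pmass t))
      \<le> norm l * exp (1 - 5 ^ (2 * k - 1)) * \<omega> t"
    by (simp add: bidual_left_apply)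
qed simp

text \<open>The outer limit: the bound of the inner limit, which tends to \<open>0\<close> with \<open>k\<close>, holds in the norm of
  the dual, and so it survives the application of an arbitrary \<open>\<Psi>\<close> in between.\<close>

lemma box_sandwich_eq_0:
  assumes \<Phi>: "weak_star_lim (\<lambda>i. bidual_embed (gseq (h i))) \<Phi> F"
    and F: "F \<noteq> bot" "filterlim h sequentially F"
  shows "\<Phi> \<box> (\<Psi> \<box> \<Phi>) = 0"
proof (rule cdual_eqI)
  fix l
  let ?l = "bidual_left (\<Psi> \<box> \<Phi>) l"
  have bound: "norm (capply ?l (gseq k)) \<le> norm \<Psi> * norm l * exp (1 - real k)" if "k \<ge> 1" for k
  proof -
    have "k \<le> 5 ^ (2 * k - 1)"
      using power_gt_expt[of 5 "2 * k - 1"] that by simp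
    then have "real k \<le> 5 ^ (2 * k - 1)"
      by (metis of_nat_le_iff of_nat_numeral of_nat_power)
    then have "norm (bidual_left \<Phi> (dual_right l (gseq k))) \<le> norm l * exp (1 - real k)"
      using norm_inner_limit_le[OF \<Phi> F that, of l]
      by (elim order_trans) (auto intro!: mult_left_mono)
    moreover have "capply ?l (gseq k) = capply \<Psi> (bidual_left \<Phi> (dual_right l (gseq k)))"
      by (simp add: bidual_left_apply arens_box_apply)
    ultimately show ?thesis
      using norm_capply[of \<Psi> "bidual_left \<Phi> (dual_right l (gseq k))"]
      by (smt (verit) mult.assoc mult_left_mono norm_ge_zero)
  qed
  have "filterlim (\<lambda>k. 1 - real k) at_bot sequentially"
    unfolding filterlim_at_bot
  proof
    fix z :: real
    show "\<forall>\<^sub>F k in sequentially. 1 - real k \<le> z"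
      by (rule eventually_sequentiallyI[of "nat \<lceil>1 - z\<rceil>"]) linarith
  qed
  then have "((\<lambda>i. exp (1 - real (h i))) \<longlongrightarrow> 0) F"
    by (intro filterlim_compose[OF exp_at_bot] filterlim_compose[OF _ F(2)])
  then have "((\<lambda>i. norm \<Psi> * norm l * exp (1 - real (h i))) \<longlongrightarrow> 0) F"
    using tendsto_mult_right_zero by blast
  moreover have "\<forall>\<^sub>F i in F. norm (capply ?l (gseq (h i))) \<le> norm \<Psi> * norm l * exp (1 - real (h i))"
    using bound by (rule eventually_filterlim_sequentially[OF F(2)])
  ultimately have "((\<lambda>i. capply ?l (gseq (h i))) \<longlongrightarrow> 0) F"
    by (rule Lim_null_comparison[rotated])
  then have "capply \<Phi> ?l = 0"
    using \<Phi> tendsto_unique[OF F(1)] unfolding weak_star_lim_def bidual_embed_apply by blast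
  then show "capply (\<Phi> \<box> (\<Psi> \<box> \<Phi>)) l = capply 0 l"
    by (simp add: arens_box_apply capply_zero)
qed

text \<open>The left ideal is \<open>{\<Psi> \<box> \<Phi>}\<close>; it contains \<open>\<Phi>\<close> since the algebra has a unit, and all its elements
  have square zero.\<close>

lemma mem_jacobson_rad_box:
  assumes zero: "\<And>\<Psi>. \<Phi> \<box> (\<Psi> \<box> \<Phi>) = 0"
  shows "\<Phi> \<in> jacobson_rad ((\<box>) :: beurling cdual cdual \<Rightarrow> _)"
proof -
  define I where "I = range (\<lambda>\<Psi>. \<Psi> \<box> \<Phi>)"
  have "left_ideal (\<box>) I"
    unfolding left_ideal_def I_def
    by (auto simp: arens_box_linear[symmetric] arens_box_assoc[symmetric] intro: range_eqI[of _ _ 0])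
  moreover have "quasi_nilpotent (\<box>) x" if "x \<in> I" for x
  proof -
    have sq: "x \<box> x = 0"
      using that by (auto simp: I_def arens_box_assoc zero arens_box_linear)
    have "mpow (\<box>) x (Suc n) = 0" for n
      by (induction n) (simp_all add: sq arens_box_linear)
    then have "(\<lambda>n. root (Suc (Suc n)) (norm (mpow (\<box>) x (Suc n)))) \<longlonglongrightarrow> 0" by simp
    then show ?thesis unfolding quasi_nilpotent_def by (rule filterlim_sequentially_Suc[THEN iffD1])
  qed
  moreover have "\<Phi> \<in> I" unfolding I_def using bidual_embed_one_box[of \<Phi>] by (metis rangeI)
  ultimately show ?thesis unfolding jacobson_rad_def by blast
qed

section \<open>The second Arens product\<close>

text \<open>The functionals whose values at towers are comparable with the weight. This cone is what the
  recursion for powers preserves up to the factor \<open>exp (- 1)\<close>.\<close>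

definition tower_bound :: "beurling cdual \<Rightarrow> real \<Rightarrow> bool" where
  "tower_bound l r \<longleftrightarrow> (\<forall>g s. tower g s \<longrightarrow> r * exp (real s) \<le> Re (capply l (pmass g)))"

text \<open>At a tower \<open>g\<close> the value of the new functional is the limit over \<open>k\<close> of limits over \<open>n\<close> of values of
  \<open>l\<close> at \<open>c^n p\<^sub>k g\<close>. Since \<open>n\<close> tends to infinity first, these are towers again. Normalization
  costs \<open>n\<close> and at most \<open>m + 1\<close>, one more than the score \<open>n + m\<close> that is gained.\<close>

lemma tower_bound_bidual_right:
  assumes \<Phi>: "weak_star_lim (\<lambda>i. bidual_embed (gseq (h i))) \<Phi> F"
    and F: "F \<noteq> bot" "filterlim h sequentially F"
    and \<Psi>: "weak_star_lim (\<lambda>n. bidual_embed (normalized_pmass (gc ^ n))) \<Psi> G"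
    and G: "G \<noteq> bot" "G \<le> sequentially"
    and l: "tower_bound l r" "r \<ge> 0"
  shows "tower_bound (bidual_right l (\<Psi> \<diamondop> \<Phi>)) (r * exp (- 1))"
  unfolding tower_bound_def
proof (intro allI impI)
  fix g s assume g: "tower g s"
  let ?l = "dual_left (pmass g) l"
  have inner: "r * exp (- 1) * exp (real s) \<le> Re (capply (dual_left (gseq k) ?l) (normalized_pmass (gc ^ n)))"
    if k: "k \<ge> 2" and n: "n \<ge> 25 ^ k + count_list (Rep_free_group g) B" for k n
  proof -
    define m :: nat where "m = 5 ^ (2 * k - 1)"
    define u where "u = gc ^ n * pk k * g"
    have "tower u (n + m + s)"
      unfolding u_def m_def by (rule tower_mult) (use g k n in auto)
    then have "r * exp (real (n + m + s)) \<le> Re (capply l (pmass u))"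
      using l unfolding tower_bound_def by blast
    moreover from this l(2) have "0 \<le> Re (capply l (pmass u))"
      by (smt (verit) exp_ge_zero mult_nonneg_nonneg)
    moreover have "\<omega> (gc ^ n) \<le> exp (real n)" "\<omega> (pk k) \<le> exp (real m + 1)"
      using of_nat_mono[OF word_length_power[OF gen_in_X3(3)], where ?'a = real, of n]
        of_nat_mono[OF word_length_pk_le[OF k], where ?'a = real] by (simp_all add: \<omega>_def m_def)
    ultimately have "r * exp (real (n + m + s)) / (exp (real n) * exp (real m + 1))
        \<le> Re (capply l (pmass u)) / (\<omega> (gc ^ n) * \<omega> (pk k))"
      using l(2) by (intro frac_le mult_mono) auto
    moreover have "r * exp (real (n + m + s)) / (exp (real n) * exp (real m + 1)) = r * exp (- 1) * exp (real s)"
      by (simp add: exp_add exp_minus field_simps)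
    moreover have "capply (dual_left (gseq k) ?l) (normalized_pmass (gc ^ n))
        = complex_of_real (1 / (\<omega> (gc ^ n) * \<omega> (pk k))) * capply l (pmass u)"
      by (simp add: dual_left_apply gseq_eq normalized_pmass_def mult_scaleC_left mult_scaleC_right
          pmass_mult capply_scaleC u_def)
    ultimately show ?thesis by simp
  qed
  have mid: "r * exp (- 1) * exp (real s) \<le> Re (capply (bidual_right ?l \<Psi>) (gseq k))"
    if "k \<ge> 2" for k
  proof -
    have "\<forall>\<^sub>F n in G. r * exp (- 1) * exp (real s)
        \<le> Re (capply (bidual_embed (normalized_pmass (gc ^ n))) (dual_left (gseq k) ?l))"
      unfolding bidual_embed_apply
      by (rule filter_leD[OF G(2)], rule eventually_sequentiallyI, rule inner[OF that])
    then show ?thesis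
      unfolding bidual_right_apply by (rule Re_weak_star_lim_ge[OF \<Psi> G(1)])
  qed
  have "\<forall>\<^sub>F i in F. r * exp (- 1) * exp (real s)
      \<le> Re (capply (bidual_embed (gseq (h i))) (bidual_right ?l \<Psi>))"
    unfolding bidual_embed_apply by (rule eventually_filterlim_sequentially[OF F(2) mid])
  then have "r * exp (- 1) * exp (real s) \<le> Re (capply \<Phi> (bidual_right ?l \<Psi>))"
    by (rule Re_weak_star_lim_ge[OF \<Phi> F(1)])
  then show "r * exp (- 1) * exp (real s) \<le> Re (capply (bidual_right l (\<Psi> \<diamondop> \<Phi>)) (pmass g))"
    by (simp add: bidual_right_apply arens_diamond_apply)
qed

text \<open>In \<open>\<diamondop>\<close> the leftmost factor acts on the functional first, so each factor of the power multiplies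
  the constant of the cone by \<open>exp (- 1)\<close>; the end of the recursion is the trivial tower.\<close>

lemma Re_mpow_diamond_ge:
  assumes step: "\<And>l r. tower_bound l r \<Longrightarrow> r \<ge> 0 \<Longrightarrow> tower_bound (bidual_right l \<Theta>) (r * exp (- 1))"
    and l: "tower_bound l r" "r \<ge> 0"
  shows "r * exp (- 1) ^ Suc n \<le> Re (capply (mpow (\<diamondop>) \<Theta> n) l)"
  using l
proof (induction n arbitrary: l r)
  case (0 l r)
  have "dual_left (pmass 1) l = l" by (rule cdual_eqI) (simp add: dual_left_apply pmass_one)
  then have "capply (bidual_right l \<Theta>) (pmass 1) = capply \<Theta> l" by (simp add: bidual_right_apply)
  then show ?case
    using step[OF 0] tower_one unfolding tower_bound_def by fastforce
next
  case (Suc n)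
  then show ?case
    using Suc.IH[OF step[OF Suc.prems]] by (simp add: arens_diamond_apply mult.assoc)
qed

lemma not_mem_jacobson_rad_diamond:
  assumes \<Phi>: "weak_star_lim (\<lambda>i. bidual_embed (gseq (h i))) \<Phi> F"
    and F: "F \<noteq> bot" "filterlim h sequentially F"
  shows "\<Phi> \<notin> jacobson_rad (\<diamondop>)"
proof
  assume "\<Phi> \<in> jacobson_rad (\<diamondop>)"
  then obtain I where I: "left_ideal (\<diamondop>) I" "\<forall>x\<in>I. quasi_nilpotent (\<diamondop>) x" "\<Phi> \<in> I"
    unfolding jacobson_rad_def by blast
  have "norm (bidual_embed (normalized_pmass (gc ^ n))) \<le> 1" for n
    using norm_capply[where x = "normalized_pmass (gc ^ n)"]
    by (intro norm_cdual_bound) (simp_all add: bidual_embed_apply norm_normalized_pmass)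
  then obtain \<Psi> G where G: "G \<le> sequentially" "G \<noteq> bot"
      and \<Psi>: "weak_star_lim (\<lambda>n. bidual_embed (normalized_pmass (gc ^ n))) \<Psi> G"
    using weak_star_cluster_point by metis
  let ?\<Theta> = "\<Psi> \<diamondop> \<Phi>"
  have "tower_bound weight_functional 1"
    using tower_le_word_length by (auto simp: tower_bound_def weight_functional_pmass \<omega>_def)
  then have pow: "exp (- 1) ^ Suc n \<le> Re (capply (mpow (\<diamondop>) ?\<Theta> n) weight_functional)" for n
    using Re_mpow_diamond_ge[OF tower_bound_bidual_right[OF \<Phi> F \<Psi> G(2,1)], of weight_functional 1 n] by simp
  have "exp (- 1) ^ Suc n \<le> norm (mpow (\<diamondop>) ?\<Theta> n)" for n
  proof -
    have "exp (- 1) ^ Suc n \<le> norm (capply (mpow (\<diamondop>) ?\<Theta> n) weight_functional)"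
      using pow[of n] complex_Re_le_cmod order_trans by blast
    also have "\<dots> \<le> norm (mpow (\<diamondop>) ?\<Theta> n) * norm weight_functional" by (rule norm_capply)
    also have "\<dots> \<le> norm (mpow (\<diamondop>) ?\<Theta> n)"
      using norm_weight_functional by (simp add: mult_left_le)
    finally show ?thesis .
  qed
  then have "exp (- 1) \<le> root (Suc n) (norm (mpow (\<diamondop>) ?\<Theta> n))" for n
    using real_root_le_mono[of "Suc n" "exp (- 1) ^ Suc n"]
    by (metis exp_ge_zero real_root_power_cancel zero_less_Suc)
  moreover have "quasi_nilpotent (\<diamondop>) ?\<Theta>"
    using I unfolding left_ideal_def by blast
  ultimately have "exp (- 1) \<le> (0::real)"
    unfolding quasi_nilpotent_def using LIMSEQ_le_const by blast
  then show False by simp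
qed

theorem theorem6p5:
  fixes D :: "'i set" and le :: "'i \<Rightarrow> 'i \<Rightarrow> bool" and h :: "'i \<Rightarrow> nat"
    and \<Phi>\<^sub>0 :: "beurling cdual cdual"
  assumes "subnet_map D le {1..} (\<le>) h"
    and "weak_star_lim (\<lambda>i. bidual_embed (gseq (h i))) \<Phi>\<^sub>0 (net_filter D le)"
  shows "\<Phi>\<^sub>0 \<in> jacobson_rad (\<box>) \<and> \<Phi>\<^sub>0 \<notin> jacobson_rad (\<diamondop>)"
proof -
  have F: "net_filter D le \<noteq> bot" "filterlim h sequentially (net_filter D le)"
    using net_filter_neq_bot subnet_map_filterlim[OF assms(1)] assms(1)
    unfolding subnet_map_def by blast+
  show ?thesis
    using mem_jacobson_rad_box[OF box_sandwich_eq_0[OF assms(2) F]]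
      not_mem_jacobson_rad_diamond[OF assms(2) F] by blast
qed

end
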